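(* Let $(\mathcal{H}_1,\mathfrak{A}_0)$ and $(\mathcal{H}_2,\mathfrak{B}_0)$ be unital Hilbert quasi *-algebras and let $(\mathcal{H}_1\widehat{\otimes}^h\mathcal{H}_2,\ \mathfrak{A}_0\otimes\mathfrak{B}_0)$ be their tensor product Hilbert quasi *-algebra. Let $\phi_1\in\mathcal{S}_{\mathfrak{A}_0}(\mathcal{H}_1)$ and $\phi_2\in\mathcal{S}_{\mathfrak{B}_0}(\mathcal{H}_2)$. Then $\phi_1\widehat{\otimes}\phi_2\in\mathcal{S}_{\mathfrak{A}_0\otimes\mathfrak{B}_0}(\mathcal{H}_1\widehat{\otimes}^h\mathcal{H}_2)$; that is, writing $\Phi:=\phi_1\widehat{\otimes}\phi_2$, the form $\Phi$ is a (continuous) sesquilinear form on $\mathcal{H}_1\widehat{\otimes}^h\mathcal{H}_2$ satisfying: (i) $\Phi(\psi,\psi)\geq 0$ for all $\psi\in\mathcal{H}_1\widehat{\otimes}^h\mathcal{H}_2$; (ii) $\Phi(\psi z,z')=\Phi(z,\psi^*z')$ for all $\psi\in\mathcal{H}_1\widehat{\otimes}^h\mathcal{H}_2$ and $z,z'\in\mathfrak{A}_0\otimes\mathfrak{B}_0$; (iii) $|\Phi(\psi,\psi')|\leq\|\psi\|_h\,\|\psi'\|_h$ for all $\psi,\psi'\in\mathcal{H}_1\widehat{\otimes}^h\mathcal{H}_2$.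
   Context: All vector spaces are complex; inner products $\langle\cdot|\cdot\rangle$ and sesquilinear forms are linear in the first variable and conjugate-linear in the second. Quasi *-algebra: a pair $(\mathfrak{A},\mathfrak{A}_0)$ of a vector space $\mathfrak{A}$ and a *-algebra $\mathfrak{A}_0$ contained in $\mathfrak{A}$ as a subspace, such that (a) the left and right multiplications $ax$ and $xa$ of $a\in\mathfrak{A}$ and $x\in\mathfrak{A}_0$ are always defined (with values in $\mathfrak{A}$) and bilinear; (b) $(xa)y=x(ay)$ and $a(xy)=(ax)y$ for $x,y\in\mathfrak{A}_0$, $a\in\mathfrak{A}$; (c) an involution $*$ extending that of $\mathfrak{A}_0$ is defined on $\mathfrak{A}$ with $(ax)^*=x^*a^*$ and $(xa)^*=a^*x^*$ for $a\in\mathfrak{A}$, $x\in\mathfrak{A}_0$. It is unital if there is an element $\mathbf{1}\in\mathfrak{A}_0$ with $a\mathbf{1}=a=\mathbf{1}a$ for all $a\in\mathfrak{A}$. Hilbert quasi *-algebra: let $\mathfrak{A}_0$ be a *-algebra which is also a pre-Hilbert space with inner product $\langle\cdot|\cdot\rangle$ such that (1) for each $x\in\mathfrak{A}_0$ the map $y\mapsto xy$ is continuous for the norm defined by the inner product; (2) $\langle xy|z\rangle=\langle y|x^*z\rangle$ for all $x,y,z\in\mathfrak{A}_0$; (3) $\langle x|y\rangle=\langle y^*|x^*\rangle$ for all $x,y\in\mathfrak{A}_0$; (4) $\mathfrak{A}_0^2$ (the set of products $xy$ with $x,y\in\mathfrak{A}_0$) is total in $\mathfrak{A}_0$. Such an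 $\mathfrak{A}_0$ is called a Hilbert algebra. If $\mathcal{H}$ is the Hilbert space completion of $\mathfrak{A}_0$, then $(\mathcal{H},\mathfrak{A}_0)$ is called a Hilbert quasi *-algebra; the involution of $\mathfrak{A}_0$ and the left and right multiplications by elements of $\mathfrak{A}_0$ are extended to $\mathcal{H}$ by continuity. Its norm is the Hilbert space norm. The set $\mathcal{S}_{\mathfrak{A}_0}(\mathcal{H})$: for a Hilbert quasi *-algebra $(\mathcal{H},\mathfrak{A}_0)$, $\mathcal{S}_{\mathfrak{A}_0}(\mathcal{H})$ is the set of all continuous sesquilinear forms $\Omega:\mathcal{H}\times\mathcal{H}\to\mathbb{C}$ such that (i) $\Omega(a,a)\geq0$ for all $a\in\mathcal{H}$; (ii) $\Omega(ax,y)=\Omega(x,a^*y)$ for all $a\in\mathcal{H}$ and $x,y\in\mathfrak{A}_0$; (iii) $|\Omega(a,b)|\leq\|a\|\,\|b\|$ for all $a,b\in\mathcal{H}$. Tensor product Hilbert quasi *-algebra: let $(\mathcal{H}_1,\mathfrak{A}_0)$ and $(\mathcal{H}_2,\mathfrak{B}_0)$ be unital Hilbert quasi *-algebras with inner products $\langle\cdot|\cdot\rangle_1$ and $\langle\cdot|\cdot\rangle_2$. The algebraic tensor product $\mathfrak{A}_0\otimes\mathfrak{B}_0$ carries its canonical *-algebra structure, $(x\otimes y)(x'\otimes y')=xx'\otimes yy'$ and $(x\otimes y)^*=x^*\otimes y^*$, and the inner product $$\langle z|z'\rangle:=\sum_{i=1}^n\sum_{j=1}^m\langle x_i|x'_j\rangle_1\langle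 y_i|y'_j\rangle_2,\qquad z=\sum_{i=1}^n x_i\otimes y_i,\quad z'=\sum_{j=1}^m x'_j\otimes y'_j,$$ with induced norm $\|\cdot\|_h$. With this structure $\mathfrak{A}_0\otimes\mathfrak{B}_0$ is a Hilbert algebra. Its completion coincides with the Hilbert space tensor product $\mathcal{H}_1\widehat{\otimes}^h\mathcal{H}_2$ (the completion of the algebraic tensor product $\mathcal{H}_1\otimes\mathcal{H}_2$ in the norm $\|\cdot\|_h$ given by the same formula for the inner product), and $(\mathcal{H}_1\widehat{\otimes}^h\mathcal{H}_2,\mathfrak{A}_0\otimes\mathfrak{B}_0)$ is a Hilbert quasi *-algebra, called the tensor product Hilbert quasi *-algebra. Tensor product of forms: for continuous sesquilinear forms $\phi_1$ on $\mathcal{H}_1$ and $\phi_2$ on $\mathcal{H}_2$, $\phi_1\otimes\phi_2$ is the sesquilinear form on the algebraic tensor product $\mathcal{H}_1\otimes\mathcal{H}_2$ given by $$(\phi_1\otimes\phi_2)(\zeta,\zeta'):=\sum_{i=1}^n\sum_{j=1}^m\phi_1(\xi_i,\xi'_j)\,\phi_2(\eta_i,\eta'_j),\qquad \zeta=\sum_{i=1}^n\xi_i\otimes\eta_i,\quad \zeta'=\sum_{j=1}^m\xi'_j\otimes\eta'_j.$$ It is continuous with respect to $\|\cdot\|_h$, and $\phi_1\widehat{\otimes}\phi_2$ denotes its unique continuous extension to a sesquilinear form on $\mathcal{H}_1\widehat{\otimes}^h\mathcal{H}_2$. *)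

theory Defs
  imports "HOL-Analysis.Analysis"
begin

text \<open>
  Complex pre-Hilbert and Hilbert spaces. The inner product is linear in the first and
  conjugate-linear in the second variable; norm and topology are those of the underlying
  real normed space.
\<close>

class complex_inner = real_normed_vector +
  fixes scaleC :: "complex \<Rightarrow> 'a \<Rightarrow> 'a"  (infixr "*\<^sub>C" 75)
    and cinner :: "'a \<Rightarrow> 'a \<Rightarrow> complex"
  assumes scaleR_scaleC: "r *\<^sub>R x = complex_of_real r *\<^sub>C x"
    and scaleC_add_right: "c *\<^sub>C (x + y) = c *\<^sub>C x + c *\<^sub>C y"
    and scaleC_add_left: "(c + d) *\<^sub>C x = c *\<^sub>C x + d *\<^sub>C x"
    and scaleC_scaleC: "c *\<^sub>C d *\<^sub>C x = (c * d) *\<^sub>C x"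
    and scaleC_one: "1 *\<^sub>C x = x"
    and cinner_add_left: "cinner (x + y) z = cinner x z + cinner y z"
    and cinner_scaleC_left: "cinner (c *\<^sub>C x) y = c * cinner x y"
    and cinner_commute: "cinner x y = cnj (cinner y x)"
    and norm_eq_sqrt_cinner: "norm x = sqrt (Re (cinner x x))"

class complex_hilbert = complex_inner + complete_space

global_interpretation complex_vector:
  vector_space "scaleC :: complex \<Rightarrow> 'a \<Rightarrow> 'a::complex_inner"
  by unfold_locales
    (simp_all add: scaleC_add_right scaleC_add_left scaleC_scaleC scaleC_one)


text \<open>
  The products \<open>x a\<close> and \<open>a x\<close> with \<open>x\<close> in the algebra \<open>A\<close> and \<open>a\<close> in the whole space are given
  by a single function \<open>mul\<close>; its values at pairs outside \<open>A \<times> UNIV \<union> UNIV \<times> A\<close> are irrelevant.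
\<close>

locale hilbert_algebra =
  fixes A :: "'a::complex_inner set"
    and mul :: "'a \<Rightarrow> 'a \<Rightarrow> 'a"  (infixl "\<cdot>" 70)
    and star :: "'a \<Rightarrow> 'a"
  assumes subspace: "complex_vector.subspace A"
    and mul_closed: "\<lbrakk>x \<in> A; y \<in> A\<rbrakk> \<Longrightarrow> x \<cdot> y \<in> A"
    and mul_add_left: "\<lbrakk>x \<in> A; y \<in> A; z \<in> A\<rbrakk> \<Longrightarrow> (x + y) \<cdot> z = x \<cdot> z + y \<cdot> z"
    and mul_add_right: "\<lbrakk>x \<in> A; y \<in> A; z \<in> A\<rbrakk> \<Longrightarrow> x \<cdot> (y + z) = x \<cdot> y + x \<cdot> z"
    and mul_scaleC_left: "\<lbrakk>x \<in> A; y \<in> A\<rbrakk> \<Longrightarrow> (c *\<^sub>C x) \<cdot> y = c *\<^sub>C (x \<cdot> y)"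
    and mul_scaleC_right: "\<lbrakk>x \<in> A; y \<in> A\<rbrakk> \<Longrightarrow> x \<cdot> (c *\<^sub>C y) = c *\<^sub>C (x \<cdot> y)"
    and mul_assoc: "\<lbrakk>x \<in> A; y \<in> A; z \<in> A\<rbrakk> \<Longrightarrow> (x \<cdot> y) \<cdot> z = x \<cdot> (y \<cdot> z)"
    and star_closed: "x \<in> A \<Longrightarrow> star x \<in> A"
    and star_add: "\<lbrakk>x \<in> A; y \<in> A\<rbrakk> \<Longrightarrow> star (x + y) = star x + star y"
    and star_scaleC: "x \<in> A \<Longrightarrow> star (c *\<^sub>C x) = cnj c *\<^sub>C star x"
    and star_star: "x \<in> A \<Longrightarrow> star (star x) = x"
    and star_mul: "\<lbrakk>x \<in> A; y \<in> A\<rbrakk> \<Longrightarrow> star (x \<cdot> y) = star y \<cdot> star x"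
    and left_mul_continuous: "x \<in> A \<Longrightarrow> continuous_on A (\<lambda>y. x \<cdot> y)"
    and cinner_mul_left: "\<lbrakk>x \<in> A; y \<in> A; z \<in> A\<rbrakk> \<Longrightarrow> cinner (x \<cdot> y) z = cinner y (star x \<cdot> z)"
    and cinner_star: "\<lbrakk>x \<in> A; y \<in> A\<rbrakk> \<Longrightarrow> cinner x y = cinner (star y) (star x)"
    and products_total: "A \<subseteq> closure (complex_vector.span {x \<cdot> y | x y. x \<in> A \<and> y \<in> A})"

text \<open>
  The completion of the pre-Hilbert space \<open>A\<close> is a Hilbert space (here: the type \<open>'a\<close>) that
  contains \<open>A\<close> as a dense subspace. A continuous map on it is the continuous extension of its
  restriction to \<open>A\<close>, so the last three assumptions say that the operations on \<open>'a\<close> are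
  the ones of \<open>A\<close> extended by continuity.
\<close>

locale hilbert_quasi_star_algebra = hilbert_algebra A mul star
  for A :: "'a::complex_hilbert set"
    and mul :: "'a \<Rightarrow> 'a \<Rightarrow> 'a"  (infixl "\<cdot>" 70)
    and star :: "'a \<Rightarrow> 'a" +
  assumes dense: "closure A = UNIV"
    and left_mul_extended: "x \<in> A \<Longrightarrow> continuous_on UNIV (\<lambda>a. x \<cdot> a)"
    and right_mul_extended: "x \<in> A \<Longrightarrow> continuous_on UNIV (\<lambda>a. a \<cdot> x)"
    and star_extended: "continuous_on UNIV star"

locale unital_hilbert_quasi_star_algebra = hilbert_quasi_star_algebra +
  assumes unital: "\<exists>e\<in>A. \<forall>a. a \<cdot> e = a \<and> e \<cdot> a = a"


definition sesquilinear :: "('a::complex_inner \<Rightarrow> 'a \<Rightarrow> complex) \<Rightarrow> bool" where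
  "sesquilinear \<Omega> \<longleftrightarrow>
     (\<forall>a b c. \<Omega> (a + b) c = \<Omega> a c + \<Omega> b c) \<and>
     (\<forall>k a b. \<Omega> (k *\<^sub>C a) b = k * \<Omega> a b) \<and>
     (\<forall>a b c. \<Omega> a (b + c) = \<Omega> a b + \<Omega> a c) \<and>
     (\<forall>k a b. \<Omega> a (k *\<^sub>C b) = cnj k * \<Omega> a b)"

definition continuous_form :: "('a::complex_inner \<Rightarrow> 'a \<Rightarrow> complex) \<Rightarrow> bool" where
  "continuous_form \<Omega> \<longleftrightarrow> continuous_on UNIV (\<lambda>(a, b). \<Omega> a b)"

definition S_forms ::
    "'a::complex_hilbert set \<Rightarrow> ('a \<Rightarrow> 'a \<Rightarrow> 'a) \<Rightarrow> ('a \<Rightarrow> 'a) \<Rightarrow> ('a \<Rightarrow> 'a \<Rightarrow> complex) set" where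
  "S_forms A mul star = {\<Omega>.
     sesquilinear \<Omega> \<and> continuous_form \<Omega> \<and>
     (\<forall>a. \<Omega> a a \<in> \<real>\<^sub>\<ge>\<^sub>0) \<and>
     (\<forall>a. \<forall>x\<in>A. \<forall>y\<in>A. \<Omega> (mul a x) y = \<Omega> x (mul (star a) y)) \<and>
     (\<forall>a b. cmod (\<Omega> a b) \<le> norm a * norm b)}"


text \<open>
  The continuous extension to the whole space of a map \<open>f\<close> given on a dense set \<open>D\<close>.
\<close>

definition extension_by_continuity ::
    "'a::t2_space set \<Rightarrow> ('a \<Rightarrow> 'b::t2_space) \<Rightarrow> 'a \<Rightarrow> 'b" where
  "extension_by_continuity D f =
     (THE g. continuous_on UNIV g \<and> (\<forall>x\<in>D. g x = f x))"


definition tensor_span ::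
    "('a \<Rightarrow> 'b \<Rightarrow> 'k::complex_inner) \<Rightarrow> 'a set \<Rightarrow> 'b set \<Rightarrow> 'k set" where
  "tensor_span ten A B = complex_vector.span {ten x y | x y. x \<in> A \<and> y \<in> B}"

text \<open>
  As any completion, the Hilbert space tensor product is determined up to isometric isomorphism
  only. It is a Hilbert space \<open>'k\<close> with a bilinear map \<open>ten\<close> such that
  \<open>tensor_span ten UNIV UNIV\<close>, which then is an algebraic tensor product of \<open>'a\<close> and \<open>'b\<close>
  (see \<open>algebraic_tensor_product\<close> below), is dense and carries the inner product given by the
  formula in \<open>cinner_ten\<close>.
\<close>

locale hilbert_tensor_product =
  fixes ten :: "'a::complex_hilbert \<Rightarrow> 'b::complex_hilbert \<Rightarrow> 'k::complex_hilbert"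
  assumes linear_left: "Vector_Spaces.linear scaleC scaleC (\<lambda>x. ten x y)"
    and linear_right: "Vector_Spaces.linear scaleC scaleC (\<lambda>y. ten x y)"
    and cinner_ten:
      "\<And>(n::nat) (m::nat) \<xi> \<eta> \<xi>' \<eta>'.
       cinner (\<Sum>i<n. ten (\<xi> i) (\<eta> i)) (\<Sum>j<m. ten (\<xi>' j) (\<eta>' j)) =
       (\<Sum>i<n. \<Sum>j<m. cinner (\<xi> i) (\<xi>' j) * cinner (\<eta> i) (\<eta>' j))"
    and tensors_dense: "closure (tensor_span ten UNIV UNIV) = UNIV"

lemma cinner_self_zero_iff: "cinner x x = 0 \<longleftrightarrow> x = 0"
proof
  assume "cinner x x = 0"
  then show "x = 0"
    using norm_eq_sqrt_cinner[of x] by simp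
next
  assume "x = 0"
  then show "cinner x x = 0"
    using cinner_scaleC_left[of 0 x x] by simp
qed

lemma cinner_sum_left:
  "cinner (\<Sum>i\<in>I. f i) y = (\<Sum>i\<in>I. cinner (f i) y)"
proof -
  have "cinner 0 y = 0"
    using cinner_scaleC_left[of 0 0 y] by simp
  then show ?thesis
    by (induction I rule: infinite_finite_induct) (simp_all add: cinner_add_left)
qed

lemma (in hilbert_tensor_product) algebraic_tensor_product:
  fixes n :: nat
  assumes indep: "complex_vector.independent (\<xi> ` {..<n})" "inj_on \<xi> {..<n}"
    and zero: "(\<Sum>i<n. ten (\<xi> i) (\<eta> i)) = 0"
    and "i < n"
  shows "\<eta> i = 0"
proof -
  have "cinner (\<eta> i) y = 0" for y
  proof -
    define v where "v = (\<Sum>i<n. cinner (\<eta> i) y *\<^sub>C \<xi> i)"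
    have "cinner v x = 0" for x
    proof -
      have "cinner 0 (ten x y) = 0"
        using cinner_scaleC_left[of 0 0 "ten x y"] by simp
      then have "(\<Sum>i<n. cinner (\<xi> i) x * cinner (\<eta> i) y) = 0"
        using cinner_ten[of \<xi> \<eta> n "\<lambda>_. x" "\<lambda>_. y" 1] zero by (simp add: lessThan_Suc)
      then show ?thesis
        by (simp add: v_def cinner_sum_left cinner_scaleC_left mult.commute)
    qed
    then have "v = 0"
      using cinner_self_zero_iff by blast
    then have "(\<Sum>b\<in>\<xi> ` {..<n}. cinner (\<eta> (the_inv_into {..<n} \<xi> b)) y *\<^sub>C b) = 0"
      unfolding v_def using indep(2) by (simp add: sum.reindex the_inv_into_f_f)
    then have "cinner (\<eta> (the_inv_into {..<n} \<xi> (\<xi> i))) y = 0"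
      using complex_vector.independentD[OF indep(1) _ subset_refl,
          where u = "\<lambda>b. cinner (\<eta> (the_inv_into {..<n} \<xi> b)) y"] \<open>i < n\<close> by simp
    then show ?thesis
      using indep(2) \<open>i < n\<close> by (simp add: the_inv_into_f_f)
  qed
  then show ?thesis
    using cinner_self_zero_iff by blast
qed


definition tensor_rep ::
    "('a \<Rightarrow> 'b \<Rightarrow> 'k::complex_inner) \<Rightarrow> 'a set \<Rightarrow> 'b set \<Rightarrow>
     'k \<Rightarrow> nat \<Rightarrow> (nat \<Rightarrow> 'a) \<Rightarrow> (nat \<Rightarrow> 'b) \<Rightarrow> bool" where
  "tensor_rep ten A B z n x y \<longleftrightarrow>
     (\<forall>i<n. x i \<in> A \<and> y i \<in> B) \<and> z = (\<Sum>i<n. ten (x i) (y i))"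

text \<open>
  The operations on algebraic tensor products are given by formulas in arbitrary
  representations as finite sums of elementary tensors; the values do not depend on the
  representations.
\<close>

definition tensor_mul0 ::
    "('a \<Rightarrow> 'b \<Rightarrow> 'k::complex_inner) \<Rightarrow> 'a set \<Rightarrow> ('a \<Rightarrow> 'a \<Rightarrow> 'a) \<Rightarrow> 'b set \<Rightarrow> ('b \<Rightarrow> 'b \<Rightarrow> 'b) \<Rightarrow>
     'k \<Rightarrow> 'k \<Rightarrow> 'k" where
  "tensor_mul0 ten A mulA B mulB z z' =
     (THE w. \<exists>n x y m x' y'. tensor_rep ten A B z n x y \<and> tensor_rep ten A B z' m x' y' \<and>
        w = (\<Sum>i<n. \<Sum>j<m. ten (mulA (x i) (x' j)) (mulB (y i) (y' j))))"

definition tensor_star0 ::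
    "('a \<Rightarrow> 'b \<Rightarrow> 'k::complex_inner) \<Rightarrow> 'a set \<Rightarrow> ('a \<Rightarrow> 'a) \<Rightarrow> 'b set \<Rightarrow> ('b \<Rightarrow> 'b) \<Rightarrow> 'k \<Rightarrow> 'k" where
  "tensor_star0 ten A starA B starB z =
     (THE w. \<exists>n x y. tensor_rep ten A B z n x y \<and>
        w = (\<Sum>i<n. ten (starA (x i)) (starB (y i))))"

definition tensor_form0 ::
    "('a \<Rightarrow> 'b \<Rightarrow> 'k::complex_inner) \<Rightarrow> ('a \<Rightarrow> 'a \<Rightarrow> complex) \<Rightarrow> ('b \<Rightarrow> 'b \<Rightarrow> complex) \<Rightarrow>
     'k \<Rightarrow> 'k \<Rightarrow> complex" where
  "tensor_form0 ten \<phi>\<^sub>1 \<phi>\<^sub>2 \<zeta> \<zeta>' =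
     (THE c. \<exists>n \<xi> \<eta> m \<xi>' \<eta>'.
        tensor_rep ten UNIV UNIV \<zeta> n \<xi> \<eta> \<and> tensor_rep ten UNIV UNIV \<zeta>' m \<xi>' \<eta>' \<and>
        c = (\<Sum>i<n. \<Sum>j<m. \<phi>\<^sub>1 (\<xi> i) (\<xi>' j) * \<phi>\<^sub>2 (\<eta> i) (\<eta>' j)))"

text \<open>
  The operations of the tensor product Hilbert quasi *-algebra with algebra
  \<open>tensor_span ten A B\<close>. In \<open>tensor_mul\<close> the first two cases agree if both factors belong to the
  algebra; the value \<open>0\<close> is a dummy for pairs whose product is not defined.
\<close>

definition tensor_mul ::
    "('a \<Rightarrow> 'b \<Rightarrow> 'k::complex_inner) \<Rightarrow> 'a set \<Rightarrow> ('a \<Rightarrow> 'a \<Rightarrow> 'a) \<Rightarrow> 'b set \<Rightarrow> ('b \<Rightarrow> 'b \<Rightarrow> 'b) \<Rightarrow>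
     'k \<Rightarrow> 'k \<Rightarrow> 'k" where
  "tensor_mul ten A mulA B mulB \<psi> \<psi>' =
     (if \<psi>' \<in> tensor_span ten A B then
        extension_by_continuity (tensor_span ten A B) (\<lambda>z. tensor_mul0 ten A mulA B mulB z \<psi>') \<psi>
      else if \<psi> \<in> tensor_span ten A B then
        extension_by_continuity (tensor_span ten A B) (\<lambda>z. tensor_mul0 ten A mulA B mulB \<psi> z) \<psi>'
      else 0)"

definition tensor_star ::
    "('a \<Rightarrow> 'b \<Rightarrow> 'k::complex_inner) \<Rightarrow> 'a set \<Rightarrow> ('a \<Rightarrow> 'a) \<Rightarrow> 'b set \<Rightarrow> ('b \<Rightarrow> 'b) \<Rightarrow> 'k \<Rightarrow> 'k" where
  "tensor_star ten A starA B starB =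
     extension_by_continuity (tensor_span ten A B) (tensor_star0 ten A starA B starB)"

definition tensor_form ::
    "('a \<Rightarrow> 'b \<Rightarrow> 'k::complex_inner) \<Rightarrow> ('a \<Rightarrow> 'a \<Rightarrow> complex) \<Rightarrow> ('b \<Rightarrow> 'b \<Rightarrow> complex) \<Rightarrow>
     'k \<Rightarrow> 'k \<Rightarrow> complex" where
  "tensor_form ten \<phi>\<^sub>1 \<phi>\<^sub>2 \<psi> \<psi>' =
     extension_by_continuity (tensor_span ten UNIV UNIV \<times> tensor_span ten UNIV UNIV)
       (\<lambda>(\<zeta>, \<zeta>'). tensor_form0 ten \<phi>\<^sub>1 \<phi>\<^sub>2 \<zeta> \<zeta>') (\<psi>, \<psi>')"

end

theory Submission
  imports Defs
begin

text \<open>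
  By Schur's product theorem the tensor product of two positive sesquilinear forms is positive.
  Applied to \<open>\<phi>\<^sub>i\<close> and \<open>cinner - \<phi>\<^sub>i\<close> this gives positivity of \<open>\<phi>\<^sub>1 \<otimes> \<phi>\<^sub>2\<close> and, with the
  Cauchy--Schwarz inequality, its bound by the norm; applied to \<open>C\<^sup>2 cinner u v - cinner (R u) (R v)\<close>
  it shows that tensor products of bounded operators, in particular multiplications by algebra
  elements, are bounded. These bounds also make all values independent of the chosen
  representations, and the identities on the algebraic tensor products extend by density.
\<close>

section \<open>Positive forms\<close>

text \<open>The operations on tensors are \<open>THE\<close> descriptions over all representations,
  so none of them can be evaluated before independence of the representation is known. The way round
  is to compute on lists. Each quantity in question is additive under concatenation and changes sign
  under scaling by -1, so a bound by \<open>norm (tsum ten us)\<close> can be applied to a list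
  standing for the difference of two others. Equal tensors then give equal values, and the same
  estimate is the Lipschitz condition behind the extension to the completion.

  Lists may contain repeated or linearly dependent vectors, so Schur's theorem is proved by
  eliminating one pair at a time instead of choosing a basis. The involution is conjugate-linear and
  hence not a tensor product of linear operators; it is controlled by being isometric.\<close>

definition positive_form :: "('a::complex_inner \<Rightarrow> 'a \<Rightarrow> complex) \<Rightarrow> bool" where
  "positive_form P \<longleftrightarrow> sesquilinear P \<and> (\<forall>a. P a a \<in> \<real>\<^sub>\<ge>\<^sub>0)"

lemma positive_form_sesquilinear: "positive_form P \<Longrightarrow> sesquilinear P"
  and positive_form_nonneg: "positive_form P \<Longrightarrow> P a a \<in> \<real>\<^sub>\<ge>\<^sub>0"
  by (auto simp: positive_form_def)

lemma sesquilinearD: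
  assumes "sesquilinear P"
  shows "P (a + b) c = P a c + P b c" "P (k *\<^sub>C a) b = k * P a b"
    "P a (b + c) = P a b + P a c" "P a (k *\<^sub>C b) = cnj k * P a b"
  using assms by (auto simp: sesquilinear_def)

lemma sesquilinear_zero:
  assumes "sesquilinear P"
  shows "P 0 a = 0" "P a 0 = 0"
  using sesquilinearD(1)[OF assms, of 0 0 a] sesquilinearD(3)[OF assms, of a 0 0] by auto

text \<open>Stated for bare complex coefficients so that it serves both positive forms on a vector
  space and the values of \<open>fsum\<close> on lists, which do not form a vector space.
  Restricting \<open>c\<close> to real multiples of \<open>B\<close> leaves a real quadratic
  polynomial.\<close>

lemma nonneg_quadratic_cauchy_schwarz:
  fixes A B B' D :: complex
  assumes nonneg: "\<And>c. A + cnj c * B + c * B' + c * cnj c * D \<in> \<real>\<^sub>\<ge>\<^sub>0"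
    and D: "D \<in> \<real>\<^sub>\<ge>\<^sub>0"
  shows "B' = cnj B" and "(cmod B)\<^sup>2 \<le> Re A * Re D"
proof -
  have A: "Re A \<ge> 0" "Im A = 0"
    using nonneg[of 0] by (auto simp: complex_nonneg_Reals_iff)
  have D': "Re D \<ge> 0" "Im D = 0"
    using D by (auto simp: complex_nonneg_Reals_iff)
  show B': "B' = cnj B"
    \<comment> \<open>The imaginary part at \<open>c = 1\<close> gives opposite imaginary parts of
      \<open>B\<close> and \<open>B'\<close>; the one at \<open>c = \<i>\<close> gives equal real
      parts.\<close>
    using nonneg[of 1] nonneg[of \<i>] A D'
    by (auto simp: complex_nonneg_Reals_iff complex_eq_iff)
  have *: "0 \<le> Re A + 2 * t * (cmod B)\<^sup>2 + t\<^sup>2 * (cmod B)\<^sup>2 * Re D" for t :: real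
    using nonneg[of "of_real t * B"]
    unfolding cmod_power2
    by (simp add: complex_nonneg_Reals_iff B' D' A power2_eq_square algebra_simps)
  show "(cmod B)\<^sup>2 \<le> Re A * Re D"
  proof (cases "Re D = 0")
    case True
    have "B = 0"
    proof (rule ccontr)
      assume "B \<noteq> 0"
      then show False
        \<comment> \<open>This \<open>t\<close> makes the polynomial, affine when
          \<open>Re D = 0\<close>, take the value -1.\<close>
        using *[of "- (Re A + 1) / (2 * (cmod B)\<^sup>2)"] True by (simp add: field_simps)
    qed
    then show ?thesis using True by simp
  next
    case False
    then have "Re D > 0" using D' by simp
    then show ?thesis
      \<comment> \<open>The minimizer of the quadratic polynomial when \<open>B\<close> is
        nonzero.\<close>
      using *[of "- 1 / Re D"] by (simp add: field_simps power2_eq_square)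
  qed
qed

lemma positive_form_quadratic:
  assumes "positive_form P"
  shows "P a a + cnj c * P a b + c * P b a + c * cnj c * P b b \<in> \<real>\<^sub>\<ge>\<^sub>0"
proof -
  note s = sesquilinearD[OF positive_form_sesquilinear[OF assms]]
  have "P (a + c *\<^sub>C b) (a + c *\<^sub>C b) = P a a + cnj c * P a b + c * P b a + c * cnj c * P b b"
    by (simp add: s algebra_simps)
  then show ?thesis
    by (metis positive_form_nonneg[OF assms])
qed

lemma
  assumes "positive_form P"
  shows positive_form_hermitian: "P b a = cnj (P a b)"
    and positive_form_cauchy_schwarz: "(cmod (P a b))\<^sup>2 \<le> Re (P a a) * Re (P b b)"
  by (rule nonneg_quadratic_cauchy_schwarz[OF positive_form_quadratic[OF assms, of a _ b]
        positive_form_nonneg[OF assms, of b]])+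

section \<open>Sums of elementary tensors\<close>

text \<open>
  Lists of pairs play the role of formal sums of elementary tensors, with concatenation as
  addition.
\<close>

definition tsum :: "('a \<Rightarrow> 'b \<Rightarrow> 'k::monoid_add) \<Rightarrow> ('a \<times> 'b) list \<Rightarrow> 'k" where
  "tsum ten us = (\<Sum>(x, y)\<leftarrow>us. ten x y)"

definition fsum :: "('a \<Rightarrow> 'a \<Rightarrow> complex) \<Rightarrow> ('b \<Rightarrow> 'b \<Rightarrow> complex) \<Rightarrow>
    ('a \<times> 'b) list \<Rightarrow> ('a \<times> 'b) list \<Rightarrow> complex" where
  "fsum P Q us vs = (\<Sum>(x, y)\<leftarrow>us. \<Sum>(x', y')\<leftarrow>vs. P x x' * Q y y')"

text \<open>Since c(x tensor y) = (c x) tensor y, the scalar goes into the first factor; closure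
  under scalars is therefore asked of the first factor in later lemmas.\<close>

definition scale_list :: "complex \<Rightarrow> ('a::complex_inner \<times> 'b) list \<Rightarrow> ('a \<times> 'b) list" where
  "scale_list c us = map (\<lambda>(x, y). (c *\<^sub>C x, y)) us"

lemma tsum_simps [simp]:
  "tsum ten [] = 0" "tsum ten ((x, y) # us) = ten x y + tsum ten us"
  "tsum ten (us @ vs) = tsum ten us + tsum ten vs"
  by (simp_all add: tsum_def)

lemma scale_list_simps [simp]:
  "scale_list c [] = []" "scale_list c ((x, y) # us) = (c *\<^sub>C x, y) # scale_list c us"
  "scale_list c (us @ vs) = scale_list c us @ scale_list c vs"
  by (simp_all add: scale_list_def)

lemma fsum_Nil [simp]: "fsum P Q [] vs = 0" "fsum P Q us [] = 0"
  by (simp_all add: fsum_def case_prod_unfold)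

lemma fsum_Cons1:
  "fsum P Q ((x, y) # us) vs = (\<Sum>(x', y')\<leftarrow>vs. P x x' * Q y y') + fsum P Q us vs"
  by (simp add: fsum_def)

lemma fsum_Cons2:
  "fsum P Q us ((x', y') # vs) = (\<Sum>(x, y)\<leftarrow>us. P x x' * Q y y') + fsum P Q us vs"
  by (induction us) (auto simp: fsum_def)

lemma fsum_append [simp]:
  "fsum P Q (us @ us') vs = fsum P Q us vs + fsum P Q us' vs"
  "fsum P Q us (vs @ vs') = fsum P Q us vs + fsum P Q us vs'"
  by (simp_all add: fsum_def case_prod_unfold sum_list_addf)

lemma fsum_scale:
  assumes "sesquilinear P"
  shows "fsum P Q (scale_list c us) vs = c * fsum P Q us vs"
    and "fsum P Q us (scale_list c vs) = cnj c * fsum P Q us vs"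
proof -
  show "fsum P Q (scale_list c us) vs = c * fsum P Q us vs"
    by (simp add: fsum_def scale_list_def case_prod_unfold o_def sesquilinearD[OF assms]
        sum_list_const_mult[symmetric] mult.assoc)
  show "fsum P Q us (scale_list c vs) = cnj c * fsum P Q us vs"
    by (simp add: fsum_def scale_list_def case_prod_unfold o_def sesquilinearD[OF assms]
        sum_list_const_mult[symmetric] mult.assoc)
qed

lemma fsum_diff:
  "fsum (\<lambda>a b. P a b - P' a b) Q us vs = fsum P Q us vs - fsum P' Q us vs"
  "fsum P (\<lambda>a b. Q a b - Q' a b) us vs = fsum P Q us vs - fsum P Q' us vs"
  by (simp_all add: fsum_def case_prod_unfold sum_list_subtractf algebra_simps)

lemma fsum_map:
  "fsum P Q (map (map_prod f g) us) (map (map_prod f g) vs) =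
   fsum (\<lambda>a b. P (f a) (f b)) (\<lambda>a b. Q (g a) (g b)) us vs"
  by (simp add: fsum_def case_prod_unfold o_def)

lemma fsum_eq_sum:
  "fsum P Q (map (\<lambda>i. (x i, y i)) [0..<n]) (map (\<lambda>j. (x' j, y' j)) [0..<m]) =
   (\<Sum>i<n. \<Sum>j<m. P (x i) (x' j) * Q (y i) (y' j))"
  by (simp add: fsum_def o_def interv_sum_list_conv_sum_set_nat atLeast0LessThan)

lemma tsum_eq_sum: "tsum ten (map (\<lambda>i. (x i, y i)) [0..<n]) = (\<Sum>i<n. ten (x i) (y i))"
  by (simp add: tsum_def o_def interv_sum_list_conv_sum_set_nat atLeast0LessThan)

text \<open>The map \<open>f\<close> is left arbitrary because two instances occur:
  \<open>ten\<close>, for inner products of tensors, and a scalar multiple of the second component,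
  for the rank one part in Schur's theorem.\<close>

lemma sesquilinear_tsum:
  assumes "sesquilinear Q"
  shows "Q (tsum f us) (tsum f vs) = (\<Sum>(x, y)\<leftarrow>us. \<Sum>(x', y')\<leftarrow>vs. Q (f x y) (f x' y'))"
proof -
  have "Q a (tsum f vs) = (\<Sum>(x', y')\<leftarrow>vs. Q a (f x' y'))" for a
    by (induction vs) (auto simp: sesquilinearD[OF assms] sesquilinear_zero[OF assms])
  then show ?thesis
    by (induction us)
      (auto simp: sesquilinearD[OF assms] sesquilinear_zero[OF assms] sum_list_addf case_prod_unfold)
qed

text \<open>
  Schur's product theorem. Subtracting from \<open>P\<close> the rank one form
  \<open>P u x * P x v / P x x\<close> leaves a positive form whose kernel contains \<open>x\<close>; the rank one form
  contributes a value of \<open>Q\<close> on the diagonal. If \<open>P x x = 0\<close>, then \<open>P x v = 0\<close> for all \<open>v\<close> and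
  the convention \<open>z / 0 = 0\<close> makes the rank one form vanish, as it should.
\<close>

lemma fsum_nonneg:
  assumes "positive_form P" "positive_form Q"
  shows "fsum P Q us us \<in> \<real>\<^sub>\<ge>\<^sub>0"
  using assms(1)
\<comment> \<open>The form has to vary, because the induction hypothesis is applied to the reduced
  form \<open>P'\<close>.\<close>
proof (induction us arbitrary: P)
  case Nil
  then show ?case by simp
next
  case (Cons p us)
  obtain x y where p: "p = (x, y)" by (cases p)
  note P = Cons.prems
  note sP = sesquilinearD[OF positive_form_sesquilinear[OF P]]
  note sQ = sesquilinearD[OF positive_form_sesquilinear[OF assms(2)]]
  have cs: "P x x = 0 \<Longrightarrow> P x v = 0 \<and> P v x = 0" for v
    using positive_form_cauchy_schwarz[OF P, of x v] positive_form_hermitian[OF P, of v x] by simp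
  define P' where "P' = (\<lambda>u v. P u v - P u x * P x v / P x x)"
  have Pxx: "Re (P x x) \<ge> 0" "Im (P x x) = 0"
    using positive_form_nonneg[OF P, of x] by (auto simp: complex_nonneg_Reals_iff)
  \<comment> \<open>On the diagonal the subtracted term is |P u x|^2 / P x x, and Cauchy-Schwarz
    bounds it by P u u.\<close>
  have "P' u u \<in> \<real>\<^sub>\<ge>\<^sub>0" for u
  proof -
    have "P x x = of_real (Re (P x x))"
      using Pxx by (simp add: complex_eq_iff)
    then have "P u x * P x u / P x x = of_real ((cmod (P u x))\<^sup>2) / of_real (Re (P x x))"
      using positive_form_hermitian[OF P, of x u] by (metis complex_norm_square of_real_power)
    then have "P u x * P x u / P x x = of_real ((cmod (P u x))\<^sup>2 / Re (P x x))"
      by simp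
    moreover have "(cmod (P u x))\<^sup>2 / Re (P x x) \<le> Re (P u u)"
      using positive_form_cauchy_schwarz[OF P, of u x] Pxx positive_form_nonneg[OF P, of u]
      by (cases "Re (P x x) = 0") (auto simp: divide_simps complex_nonneg_Reals_iff)
    moreover have "Im (P u u) = 0"
      using positive_form_nonneg[OF P, of u] by (simp add: complex_nonneg_Reals_iff)
    ultimately show ?thesis
      by (simp add: P'_def complex_nonneg_Reals_iff)
  qed
  moreover have "sesquilinear P'"
    unfolding sesquilinear_def P'_def
    by (simp add: sP algebra_simps add_divide_distrib)
  ultimately have P': "positive_form P'"
    by (simp add: positive_form_def)
  have P'x: "P' x v = 0" "P' v x = 0" for v
    using cs[of v] by (auto simp: P'_def)
  \<comment> \<open>With this \<open>f\<close>, \<open>tsum f\<close> of the list is the vector sum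
    of the P(x_i, x) y_i. Expanding \<open>Q\<close> at this vector and using cnj (P x_j x) = P x
    x_j produces exactly the coefficients of the rank one form.\<close>
  define f where "f = (\<lambda>u v. P u x *\<^sub>C (v :: 'b))"
  have "fsum P Q (p # us) (p # us) =
      fsum P' Q (p # us) (p # us) + Q (tsum f (p # us)) (tsum f (p # us)) / P x x"
    (is "_ = _ + ?R")
  proof -
    have "?R = fsum (\<lambda>u v. P u x * P x v / P x x) Q (p # us) (p # us)"
      unfolding sesquilinear_tsum[OF positive_form_sesquilinear[OF assms(2)]] fsum_def f_def
      by (simp add: case_prod_unfold sQ positive_form_hermitian[OF P, symmetric]
          sum_list_const_mult[symmetric] divide_inverse algebra_simps)
    then show ?thesis
      unfolding P'_def fsum_diff by simp
  qed
  \<comment> \<open>All terms containing the head pair vanish, since \<open>x\<close> lies in the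
    kernel of \<open>P'\<close>; this shortens the list.\<close>
  also have "fsum P' Q (p # us) (p # us) = fsum P' Q us us"
    by (simp add: p fsum_Cons1 fsum_Cons2 P'x case_prod_unfold)
  finally have eq: "fsum P Q (p # us) (p # us) = fsum P' Q us us +
      Q (tsum f (p # us)) (tsum f (p # us)) / P x x" .
  have "Q (tsum f (p # us)) (tsum f (p # us)) / P x x \<in> \<real>\<^sub>\<ge>\<^sub>0"
    by (intro nonneg_Reals_divide_I positive_form_nonneg[OF assms(2)] positive_form_nonneg[OF P])
  then show ?case
    unfolding eq by (intro nonneg_Reals_add_I Cons.IH[OF P'])
qed

text \<open>Telescoping: P' Q' - P Q = P (Q' - Q) + (P' - P) Q', and Schur's theorem applies to both
  summands. This fixes which of the four forms have to be positive.\<close>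

lemma fsum_mono:
  assumes "positive_form P" "positive_form Q'"
    and "positive_form (\<lambda>a b. P' a b - P a b)" "positive_form (\<lambda>a b. Q' a b - Q a b)"
  shows "Re (fsum P Q us us) \<le> Re (fsum P' Q' us us)"
  using fsum_nonneg[OF assms(1,4), of us] fsum_nonneg[OF assms(3,2), of us]
  by (simp add: fsum_diff complex_nonneg_Reals_iff)

text \<open>The list \<open>us @ scale_list c vs\<close> stands for us + c vs; its nonnegative
  diagonal value is the required quadratic expression in \<open>c\<close>.\<close>

lemma fsum_cauchy_schwarz:
  assumes "positive_form P" "positive_form Q"
  shows "(cmod (fsum P Q us vs))\<^sup>2 \<le> Re (fsum P Q us us) * Re (fsum P Q vs vs)"
proof (rule nonneg_quadratic_cauchy_schwarz(2))
  fix c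
  show "fsum P Q us us + cnj c * fsum P Q us vs + c * fsum P Q vs us +
      c * cnj c * fsum P Q vs vs \<in> \<real>\<^sub>\<ge>\<^sub>0"
    using fsum_nonneg[OF assms, of "us @ scale_list c vs"]
    by (simp add: fsum_scale[OF positive_form_sesquilinear[OF assms(1)]] algebra_simps)
  show "fsum P Q vs vs \<in> \<real>\<^sub>\<ge>\<^sub>0"
    by (rule fsum_nonneg[OF assms])
qed

section \<open>The inner product\<close>

lemma sesquilinear_cinner: "sesquilinear cinner"
proof -
  have "cinner a (b + c) = cinner a b + cinner a c" for a b c :: 'a
    using arg_cong[OF cinner_add_left[of b c a], of cnj] by (simp add: cinner_commute[symmetric])
  moreover have "cinner a (k *\<^sub>C b) = cnj k * cinner a b" for a b :: 'a and k
    using arg_cong[OF cinner_scaleC_left[of k b a], of cnj] by (simp add: cinner_commute[symmetric])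
  ultimately show ?thesis
    by (simp add: sesquilinear_def cinner_add_left cinner_scaleC_left)
qed

text \<open>Nonnegativity of the inner product on the diagonal is hidden in the norm axiom:
  \<open>sqrt\<close> of a negative real is negative in HOL, so a negative value would give a
  negative norm.\<close>

lemma cinner_self: "cinner x x = of_real ((norm x)\<^sup>2)"
proof -
  have "Re (cinner x x) = (norm x)\<^sup>2"
  proof (cases "Re (cinner x x) \<ge> 0")
    case True
    then show ?thesis by (simp add: norm_eq_sqrt_cinner)
  next
    case False
    then have "norm x < 0" by (simp add: norm_eq_sqrt_cinner)
    then show ?thesis by (metis norm_not_less_zero)
  qed
  moreover have "Im (cinner x x) = 0"
    using arg_cong[OF cinner_commute[of x x], of Im] by simp
  ultimately show ?thesis
    by (simp add: complex_eq_iff)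
qed

lemma positive_form_cinner: "positive_form cinner"
  by (simp add: positive_form_def sesquilinear_cinner cinner_self)

lemma norm_scaleC: "norm (c *\<^sub>C x) = cmod c * norm (x :: 'a::complex_inner)"
proof -
  have "cinner (c *\<^sub>C x) (c *\<^sub>C x) = (c * cnj c) * cinner x x"
    by (simp add: sesquilinearD[OF sesquilinear_cinner])
  then have "complex_of_real ((norm (c *\<^sub>C x))\<^sup>2) = of_real ((cmod c * norm x)\<^sup>2)"
    by (simp only: cinner_self complex_norm_square[symmetric] of_real_power of_real_mult power_mult_distrib)
  then show ?thesis
    by (metis norm_ge_zero mult_nonneg_nonneg of_real_eq_iff power2_eq_imp_eq)
qed

lemma continuous_on_scaleC [continuous_intros]:
  fixes f :: "'x::topological_space \<Rightarrow> 'a::complex_inner"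
  assumes "continuous_on S f"
  shows "continuous_on S (\<lambda>x. c *\<^sub>C f x)"
proof -
  have "bounded_linear (\<lambda>x :: 'a. c *\<^sub>C x)"
    by (rule bounded_linear_intro[where K = "cmod c"])
      (simp_all add: scaleC_add_right norm_scaleC scaleR_scaleC scaleC_scaleC mult.commute)
  then show ?thesis
    using assms by (rule bounded_linear.continuous_on)
qed

lemma scaleC_minus_one: "(- 1) *\<^sub>C x = - (x :: 'a::complex_inner)"
  using scaleR_scaleC[of "- 1" x] by simp

text \<open>Turns a norm bound into a comparison of forms, as \<open>fsum_mono\<close> expects it.
  It is used with \<open>K = 1\<close> for the given forms and with the square of an operator bound
  for pulled-back inner products.\<close>

lemma positive_form_cinner_diff:
  assumes "positive_form P" "\<And>a. cmod (P a a) \<le> K * (norm a)\<^sup>2"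
  shows "positive_form (\<lambda>a b. of_real K * cinner a b - P a b)"
proof -
  note sP = sesquilinearD[OF positive_form_sesquilinear[OF assms(1)]]
  have "of_real K * cinner a a - P a a \<in> \<real>\<^sub>\<ge>\<^sub>0" for a
  proof -
    have "Re (P a a) \<le> K * (norm a)\<^sup>2" "Im (P a a) = 0"
      using assms(2)[of a] complex_Re_le_cmod[of "P a a"] positive_form_nonneg[OF assms(1), of a]
      by (auto simp: complex_nonneg_Reals_iff)
    then show ?thesis
      unfolding complex_nonneg_Reals_iff cinner_self of_real_mult[symmetric] by simp
  qed
  moreover have "sesquilinear (\<lambda>a b. of_real K * cinner a b - P a b)"
    by (simp add: sesquilinear_def sP sesquilinearD[OF sesquilinear_cinner] algebra_simps)
  ultimately show ?thesis
    unfolding positive_form_def by blast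
qed

section \<open>Extension by continuity\<close>

lemma eq_on_dense:
  fixes f g :: "'a::topological_space \<Rightarrow> 'b::t2_space"
  assumes "closure D = UNIV" "continuous_on UNIV f" "continuous_on UNIV g"
    and "\<And>x. x \<in> D \<Longrightarrow> f x = g x"
  shows "f x = g x"
proof -
  have "closure D \<subseteq> {x. f x = g x}"
    by (rule closure_minimal) (auto intro: assms closed_Collect_eq)
  then show ?thesis using assms(1) by auto
qed

lemma le_on_dense:
  fixes f g :: "'a::topological_space \<Rightarrow> real"
  assumes "closure D = UNIV" "continuous_on UNIV f" "continuous_on UNIV g"
    and "\<And>x. x \<in> D \<Longrightarrow> f x \<le> g x"
  shows "f x \<le> g x"
proof -
  have "closure D \<subseteq> {x. f x \<le> g x}"
    by (rule closure_minimal) (auto intro: assms closed_Collect_le)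
  then show ?thesis using assms(1) by auto
qed

lemma eq_on_dense2:
  fixes f g :: "'a::topological_space \<Rightarrow> 'b::topological_space \<Rightarrow> 'c::t2_space"
  assumes "closure D = UNIV" "closure E = UNIV"
    and "continuous_on UNIV (\<lambda>p. f (fst p) (snd p))" "continuous_on UNIV (\<lambda>p. g (fst p) (snd p))"
    and "\<And>x y. \<lbrakk>x \<in> D; y \<in> E\<rbrakk> \<Longrightarrow> f x y = g x y"
  shows "f x y = g x y"
  using eq_on_dense[OF _ assms(3,4), of "D \<times> E" "(x, y)"] assms(1,2,5)
  by (auto simp: closure_Times)

lemma le_on_dense2:
  fixes f g :: "'a::topological_space \<Rightarrow> 'b::topological_space \<Rightarrow> real"
  assumes "closure D = UNIV" "closure E = UNIV"
    and "continuous_on UNIV (\<lambda>p. f (fst p) (snd p))" "continuous_on UNIV (\<lambda>p. g (fst p) (snd p))"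
    and "\<And>x y. \<lbrakk>x \<in> D; y \<in> E\<rbrakk> \<Longrightarrow> f x y \<le> g x y"
  shows "f x y \<le> g x y"
  using le_on_dense[OF _ assms(3,4), of "D \<times> E" "(x, y)"] assms(1,2,5)
  by (auto simp: closure_Times)

lemma extension_by_continuity_eq:
  assumes "closure D = UNIV" "continuous_on UNIV g" "\<And>x. x \<in> D \<Longrightarrow> g x = f x"
  shows "extension_by_continuity D f = g"
  unfolding extension_by_continuity_def
proof (rule the_equality)
  show "continuous_on UNIV g \<and> (\<forall>x\<in>D. g x = f x)"
    using assms by auto
  show "h = g" if "continuous_on UNIV h \<and> (\<forall>x\<in>D. h x = f x)" for h
    by (rule ext, rule eq_on_dense[OF assms(1)]) (use that assms in auto)
qed

lemma
  fixes f :: "'a::metric_space \<Rightarrow> 'b::complete_space"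
  assumes "C-lipschitz_on D f" "closure D = UNIV"
  shows continuous_on_extension_by_continuity: "continuous_on UNIV (extension_by_continuity D f)"
    and extension_by_continuity_agrees: "x \<in> D \<Longrightarrow> extension_by_continuity D f x = f x"
proof -
  obtain g where g: "C-lipschitz_on UNIV g" "\<forall>x\<in>D. g x = f x"
    using lipschitz_extend_closure[OF assms(1)] assms(2) by auto
  have eq: "extension_by_continuity D f = g"
    using g by (intro extension_by_continuity_eq assms(2) lipschitz_on_continuous_on) auto
  show "continuous_on UNIV (extension_by_continuity D f)"
    using g eq by (auto intro: lipschitz_on_continuous_on)
  show "x \<in> D \<Longrightarrow> extension_by_continuity D f x = f x"
    using g eq by auto
qed

lemma bounded_biadditive_extension:
  fixes f :: "'a::real_normed_vector \<Rightarrow> 'b::real_normed_vector \<Rightarrow> 'c::banach"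
  assumes D: "closure D = UNIV" and E: "closure E = UNIV"
    and l: "\<And>x x' y. \<lbrakk>x \<in> D; x' \<in> D; y \<in> E\<rbrakk> \<Longrightarrow> norm (f x y - f x' y) \<le> norm (x - x') * norm y"
    and r: "\<And>x y y'. \<lbrakk>x \<in> D; y \<in> E; y' \<in> E\<rbrakk> \<Longrightarrow> norm (f x y - f x y') \<le> norm x * norm (y - y')"
  obtains g where "continuous_on UNIV (\<lambda>(x, y). g x y)"
    and "\<And>x y. \<lbrakk>x \<in> D; y \<in> E\<rbrakk> \<Longrightarrow> g x y = f x y"
proof -
  have "\<exists>G. (norm y)-lipschitz_on UNIV G \<and> (\<forall>x\<in>D. G x = f x y)" if "y \<in> E" for y
  proof -
    have "(norm y)-lipschitz_on D (\<lambda>x. f x y)"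
      using l[OF _ _ that] by (intro lipschitz_onI) (auto simp: dist_norm mult.commute)
    from lipschitz_extend_closure[OF this] show ?thesis using D by auto
  qed
  then obtain G where G: "\<And>y. y \<in> E \<Longrightarrow> (norm y)-lipschitz_on UNIV (G y)"
      "\<And>x y. y \<in> E \<Longrightarrow> x \<in> D \<Longrightarrow> G y x = f x y"
    by metis
  note Gc = lipschitz_on_continuous_on[OF G(1)]
  \<comment> \<open>Density in \<open>x\<close> carries the estimate in the second variable to every
    \<open>x\<close> of the whole space, which is what the second extension needs.\<close>
  have rG: "norm (G y x - G y' x) \<le> norm x * norm (y - y')" if "y \<in> E" "y' \<in> E" for x y y'
    by (rule le_on_dense[OF D, where f = "\<lambda>x. norm (G y x - G y' x)"
        and g = "\<lambda>x. norm x * norm (y - y')"])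
      (use that in \<open>auto intro!: continuous_intros Gc simp: G r\<close>)
  have "\<exists>H. (norm x)-lipschitz_on UNIV H \<and> (\<forall>y\<in>E. H y = G y x)" for x
  proof -
    have "(norm x)-lipschitz_on E (\<lambda>y. G y x)"
      using rG by (intro lipschitz_onI) (auto simp: dist_norm)
    from lipschitz_extend_closure[OF this] show ?thesis using E by auto
  qed
  then obtain g where g: "\<And>x. (norm x)-lipschitz_on UNIV (g x)"
      "\<And>x y. y \<in> E \<Longrightarrow> g x y = G y x"
    by metis
  have lg: "norm (g x y - g x' y) \<le> norm (x - x') * norm y" for x x' y
  proof (rule le_on_dense[OF E, where f = "\<lambda>y. norm (g x y - g x' y)"
        and g = "\<lambda>y. norm (x - x') * norm y"])
    show "norm (g x y - g x' y) \<le> norm (x - x') * norm y" if "y \<in> E" for y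
      using lipschitz_onD[OF G(1)[OF that], of x x'] that by (simp add: g dist_norm mult.commute)
  qed (auto intro!: continuous_intros lipschitz_on_continuous_on[OF g(1)])
  have "((\<lambda>p. g (fst p) (snd p)) \<longlongrightarrow> g a b) (at (a, b))" for a b
  proof (rule Lim_null[THEN iffD2], rule Lim_null_comparison)
    have "((\<lambda>p. norm (fst p) * norm (snd p - b) + norm (fst p - a) * norm b) \<longlongrightarrow>
        norm (fst (a, b)) * norm (snd (a, b) - b) + norm (fst (a, b) - a) * norm b) (at (a, b))"
      by (intro tendsto_intros)
    then show "((\<lambda>p. norm (fst p) * norm (snd p - b) + norm (fst p - a) * norm b) \<longlongrightarrow> 0) (at (a, b))"
      by simp
    \<comment> \<open>Passing through \<open>g x b\<close> changes only one variable at a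
      time.\<close>
    have "norm (g x y - g a b) \<le> norm x * norm (y - b) + norm (x - a) * norm b" for x y
      using lipschitz_onD[OF g(1)[of x], of y b] lg[of x b a]
        norm_triangle_ineq[of "g x y - g x b" "g x b - g a b"] by (simp add: dist_norm)
    then show "\<forall>\<^sub>F p in at (a, b). norm (g (fst p) (snd p) - g a b) \<le>
        norm (fst p) * norm (snd p - b) + norm (fst p - a) * norm b"
      by (intro always_eventually allI) simp
  qed
  then have "continuous_on UNIV (\<lambda>(x, y). g x y)"
    unfolding continuous_on_def case_prod_unfold by (metis surj_pair fst_conv snd_conv)
  then show ?thesis
    by (rule that) (simp add: g G)
qed

text \<open>The locales assume mere continuity of multiplication by algebra elements, whereas
  Schur's comparison needs explicit operator bounds.\<close>

lemma continuous_linear_bounded: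
  fixes f :: "'a::real_normed_vector \<Rightarrow> 'b::real_normed_vector"
  assumes "linear f" "continuous_on UNIV f"
  obtains K where "K \<ge> 0" "\<And>x. norm (f x) \<le> K * norm x"
proof -
  obtain d where d: "d > 0" "\<And>x. norm x < d \<Longrightarrow> norm (f x) < 1"
  proof -
    have "\<exists>d>0. \<forall>x\<in>UNIV. dist x 0 < d \<longrightarrow> dist (f x) (f 0) < 1"
      using assms(2)[unfolded continuous_on_iff, rule_format, of 0 1] by simp
    then show ?thesis
      using that by (auto simp: linear_0[OF assms(1)])
  qed
  have "norm (f x) \<le> 2 / d * norm x" for x
  proof (cases "x = 0")
    case False
    \<comment> \<open>The rescaled vector has norm d/2, hence lies within the radius
      \<open>d\<close>; scaling back gives the constant 2/d.\<close>
    have "norm (f ((d / (2 * norm x)) *\<^sub>R x)) < 1"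
      using d False by (intro d(2)) simp
    then show ?thesis
      using False d by (simp add: linear_scale[OF assms(1)] field_simps)
  qed (simp add: linear_0[OF assms(1)])
  then show ?thesis
    using d by (intro that[of "2 / d"]) auto
qed

section \<open>The Hilbert space tensor product\<close>

definition mul_list :: "('a \<Rightarrow> 'a \<Rightarrow> 'a) \<Rightarrow> ('b \<Rightarrow> 'b \<Rightarrow> 'b) \<Rightarrow>
    ('a \<times> 'b) list \<Rightarrow> ('a \<times> 'b) list \<Rightarrow> ('a \<times> 'b) list" where
  "mul_list m n us vs =
    concat (map (\<lambda>(x, y). map (map_prod (m x) (n y)) vs) us)"

lemma mul_list_simps [simp]:
  "mul_list m n [] vs = []"
  "mul_list m n ((x, y) # us) vs = map (map_prod (m x) (n y)) vs @ mul_list m n us vs"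
  "mul_list m n (us @ us') vs = mul_list m n us vs @ mul_list m n us' vs"
  "mul_list m n us [] = []"
  by (simp_all add: mul_list_def case_prod_unfold)

text \<open>\<open>mul_list\<close> runs through the left factor in its outer loop, so splitting the
  right factor permutes the resulting list; the identity is therefore one of sums.\<close>

lemma tsum_mul_list_Cons:
  fixes ten :: "'a \<Rightarrow> 'b \<Rightarrow> 'k::comm_monoid_add"
  shows "tsum ten (mul_list m n us ((x, y) # vs)) =
    tsum ten (map (map_prod (\<lambda>a. m a x) (\<lambda>b. n b y)) us) + tsum ten (mul_list m n us vs)"
  by (induction us) (auto simp: ac_simps)

lemma tsum_mul_list_eq_sum:
  "tsum ten (mul_list m n (map (\<lambda>i. (x i, y i)) [0..<k]) (map (\<lambda>j. (x' j, y' j)) [0..<l])) =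
   (\<Sum>i<k. \<Sum>j<l. ten (m (x i) (x' j)) (n (y i) (y' j)))"
proof -
  have "tsum ten (mul_list m n us vs) = (\<Sum>(x, y)\<leftarrow>us. \<Sum>(x', y')\<leftarrow>vs. ten (m x x') (n y y'))" for us vs
    by (induction us) (auto simp: tsum_def o_def case_prod_unfold)
  then show ?thesis
    by (simp add: o_def interv_sum_list_conv_sum_set_nat atLeast0LessThan)
qed

lemma list_eq_map_pair:
  obtains x y where "us = map (\<lambda>i. (x i, y i)) [0..<length us]"
  by (rule that[of "fst \<circ> nth us" "snd \<circ> nth us"]) (simp add: map_nth)

lemma tensor_rep_iff:
  "tensor_rep ten A B z n x y \<longleftrightarrow>
   map (\<lambda>i. (x i, y i)) [0..<n] \<in> lists (A \<times> B) \<and> tsum ten (map (\<lambda>i. (x i, y i)) [0..<n]) = z"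
  by (auto simp: tensor_rep_def tsum_eq_sum in_lists_conv_set)

text \<open>Any list is an indexed family, which gives existence for \<open>THE\<close>. Uniqueness
  is the hypothesis \<open>wd\<close>, to be discharged once norm bounds are available.\<close>

lemma tensor_mul0_tsum:
  assumes "us \<in> lists (A \<times> B)" "vs \<in> lists (A \<times> B)"
    and wd: "\<And>us' vs'. \<lbrakk>us' \<in> lists (A \<times> B); vs' \<in> lists (A \<times> B); tsum ten us' = tsum ten us;
      tsum ten vs' = tsum ten vs\<rbrakk> \<Longrightarrow> tsum ten (mul_list m n us' vs') = tsum ten (mul_list m n us vs)"
  shows "tensor_mul0 ten A m B n (tsum ten us) (tsum ten vs) = tsum ten (mul_list m n us vs)"
  unfolding tensor_mul0_def tensor_rep_iff tsum_mul_list_eq_sum[symmetric]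
proof (rule the_equality)
  obtain x y where us: "us = map (\<lambda>i. (x i, y i)) [0..<length us]"
    by (rule list_eq_map_pair)
  obtain x' y' where vs: "vs = map (\<lambda>i. (x' i, y' i)) [0..<length vs]"
    by (rule list_eq_map_pair)
  show "\<exists>k x y l x' y'.
      (map (\<lambda>i. (x i, y i)) [0..<k] \<in> lists (A \<times> B) \<and>
       tsum ten (map (\<lambda>i. (x i, y i)) [0..<k]) = tsum ten us) \<and>
      (map (\<lambda>i. (x' i, y' i)) [0..<l] \<in> lists (A \<times> B) \<and>
       tsum ten (map (\<lambda>i. (x' i, y' i)) [0..<l]) = tsum ten vs) \<and>
      tsum ten (mul_list m n us vs) =
      tsum ten (mul_list m n (map (\<lambda>i. (x i, y i)) [0..<k]) (map (\<lambda>j. (x' j, y' j)) [0..<l]))"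
    by (rule exI[of _ "length us"], rule exI[of _ x], rule exI[of _ y],
        rule exI[of _ "length vs"], rule exI[of _ x'], rule exI[of _ y'],
        unfold us[symmetric] vs[symmetric]) (use assms(1,2) in simp)
qed (use wd in blast)

lemma tensor_star0_tsum:
  assumes "us \<in> lists (A \<times> B)"
    and wd: "\<And>us'. \<lbrakk>us' \<in> lists (A \<times> B); tsum ten us' = tsum ten us\<rbrakk> \<Longrightarrow>
      tsum ten (map (map_prod s t) us') = tsum ten (map (map_prod s t) us)"
  shows "tensor_star0 ten A s B t (tsum ten us) = tsum ten (map (map_prod s t) us)"
proof -
  have *: "(\<Sum>i<n. ten (s (x i)) (t (y i))) =
      tsum ten (map (map_prod s t) (map (\<lambda>i. (x i, y i)) [0..<n]))" for n x y
    by (simp add: o_def tsum_eq_sum)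
  obtain x y where us: "us = map (\<lambda>i. (x i, y i)) [0..<length us]"
    by (rule list_eq_map_pair)
  show ?thesis
    unfolding tensor_star0_def tensor_rep_iff *
  proof (rule the_equality)
    show "\<exists>k x y.
        (map (\<lambda>i. (x i, y i)) [0..<k] \<in> lists (A \<times> B) \<and>
         tsum ten (map (\<lambda>i. (x i, y i)) [0..<k]) = tsum ten us) \<and>
        tsum ten (map (map_prod s t) us) =
        tsum ten (map (map_prod s t) (map (\<lambda>i. (x i, y i)) [0..<k]))"
      by (rule exI[of _ "length us"], rule exI[of _ x], rule exI[of _ y], unfold us[symmetric])
        (use assms(1) in simp)
  qed (use wd in blast)
qed

lemma tensor_form0_tsum:
  assumes wd: "\<And>us' vs'. \<lbrakk>tsum ten us' = tsum ten us; tsum ten vs' = tsum ten vs\<rbrakk> \<Longrightarrow>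
      fsum P Q us' vs' = fsum P Q us vs"
  shows "tensor_form0 ten P Q (tsum ten us) (tsum ten vs) = fsum P Q us vs"
  unfolding tensor_form0_def tensor_rep_iff fsum_eq_sum[symmetric]
proof (rule the_equality)
  obtain x y where us: "us = map (\<lambda>i. (x i, y i)) [0..<length us]"
    by (rule list_eq_map_pair)
  obtain x' y' where vs: "vs = map (\<lambda>i. (x' i, y' i)) [0..<length vs]"
    by (rule list_eq_map_pair)
  show "\<exists>k x y l x' y'.
      (map (\<lambda>i. (x i, y i)) [0..<k] \<in> lists (UNIV \<times> UNIV) \<and>
       tsum ten (map (\<lambda>i. (x i, y i)) [0..<k]) = tsum ten us) \<and>
      (map (\<lambda>i. (x' i, y' i)) [0..<l] \<in> lists (UNIV \<times> UNIV) \<and>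
       tsum ten (map (\<lambda>i. (x' i, y' i)) [0..<l]) = tsum ten vs) \<and>
      fsum P Q us vs =
      fsum P Q (map (\<lambda>i. (x i, y i)) [0..<k]) (map (\<lambda>j. (x' j, y' j)) [0..<l])"
    by (rule exI[of _ "length us"], rule exI[of _ x], rule exI[of _ y],
        rule exI[of _ "length vs"], rule exI[of _ x'], rule exI[of _ y'],
        unfold us[symmetric] vs[symmetric]) simp
qed (use wd in blast)

section \<open>Lists versus tensors: inner product, span, density and bounds\<close>

context hilbert_tensor_product
begin

lemma ten_add_left: "ten (x + x') y = ten x y + ten x' y"
  and ten_scaleC_left: "ten (c *\<^sub>C x) y = c *\<^sub>C ten x y"
  and ten_add_right: "ten x (y + y') = ten x y + ten x y'"
  and ten_scaleC_right: "ten x (c *\<^sub>C y) = c *\<^sub>C ten x y"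
  using linear_left[of y] linear_right[of x]
  by (auto simp: Vector_Spaces.linear_def module_hom_def module_hom_axioms_def)

lemma cinner_tsum: "cinner (tsum ten us) (tsum ten vs) = fsum cinner cinner us vs"
proof -
  have "cinner (ten x y) (ten x' y') = cinner x x' * cinner y y'" for x y x' y'
    using cinner_ten[of "\<lambda>_. x" "\<lambda>_. y" 1 "\<lambda>_. x'" "\<lambda>_. y'" 1] by (simp add: lessThan_Suc)
  then show ?thesis
    by (simp add: sesquilinear_tsum[OF sesquilinear_cinner] fsum_def)
qed

lemma norm_tsum: "(norm (tsum ten us))\<^sup>2 = Re (fsum cinner cinner us us)"
  by (simp add: cinner_tsum[symmetric] cinner_self flip: of_real_power)

lemma bounded_bilinear_ten: "bounded_bilinear ten"
proof
  have "(norm (ten x y))\<^sup>2 = (norm x * norm y)\<^sup>2" for x y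
    using norm_tsum[of "[(x, y)]"]
    by (simp add: fsum_def cinner_self power_mult_distrib flip: of_real_power of_real_mult)
  then have "norm (ten x y) = norm x * norm y" for x y
    by (rule power2_eq_imp_eq) auto
  then show "\<exists>K. \<forall>x y. norm (ten x y) \<le> norm x * norm y * K"
    by (intro exI[of _ 1]) simp
qed (simp_all add: ten_add_left ten_add_right scaleR_scaleC ten_scaleC_left ten_scaleC_right)

lemma tsum_scale_list: "tsum ten (scale_list c us) = c *\<^sub>C tsum ten us"
  by (induction us) (auto simp: ten_scaleC_left scaleC_add_right)

lemma scale_list_in_lists:
  "\<lbrakk>complex_vector.subspace A; us \<in> lists (A \<times> B)\<rbrakk> \<Longrightarrow> scale_list c us \<in> lists (A \<times> B)"
  by (induction us) (auto simp: complex_vector.subspace_scale)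

text \<open>Coefficients are absorbed by the first factor, so the span consists of plain sums of
  elementary tensors, and statements about it can be checked on lists.\<close>

lemma tensor_span_eq:
  assumes "complex_vector.subspace A"
  shows "tensor_span ten A B = tsum ten ` lists (A \<times> B)"
proof
  have "complex_vector.subspace (tsum ten ` lists (A \<times> B))"
  proof (rule complex_vector.subspaceI)
    show "0 \<in> tsum ten ` lists (A \<times> B)"
      by (rule image_eqI[of _ _ "[]"]) auto
    show "u + v \<in> tsum ten ` lists (A \<times> B)"
      if "u \<in> tsum ten ` lists (A \<times> B)" "v \<in> tsum ten ` lists (A \<times> B)" for u v
    proof -
      from that obtain us vs
        where "u = tsum ten us" "v = tsum ten vs" "us \<in> lists (A \<times> B)" "vs \<in> lists (A \<times> B)"
        by blast
      then show ?thesis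
        by (intro image_eqI[of _ _ "us @ vs"]) auto
    qed
    show "c *\<^sub>C u \<in> tsum ten ` lists (A \<times> B)" if "u \<in> tsum ten ` lists (A \<times> B)" for c u
    proof -
      from that obtain us where "u = tsum ten us" "us \<in> lists (A \<times> B)"
        by blast
      then show ?thesis
        by (intro image_eqI[of _ _ "scale_list c us"])
          (auto simp only: tsum_scale_list scale_list_in_lists[OF assms])
    qed
  qed
  moreover have "{ten x y |x y. x \<in> A \<and> y \<in> B} \<subseteq> tsum ten ` lists (A \<times> B)"
  proof clarify
    fix x y assume "x \<in> A" "y \<in> B"
    then show "ten x y \<in> tsum ten ` lists (A \<times> B)"
      by (intro image_eqI[of _ _ "[(x, y)]"]) auto
  qed
  ultimately show "tensor_span ten A B \<subseteq> tsum ten ` lists (A \<times> B)"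
    unfolding tensor_span_def by (intro complex_vector.span_minimal)
  have "tsum ten us \<in> tensor_span ten A B" if "us \<in> lists (A \<times> B)" for us
    using that
  proof (induction us)
    case (Cons p us)
    then show ?case
      unfolding tensor_span_def
      by (cases p) (auto intro!: complex_vector.span_add intro: complex_vector.span_base)
  qed (simp add: tensor_span_def complex_vector.span_zero)
  then show "tsum ten ` lists (A \<times> B) \<subseteq> tensor_span ten A B" by auto
qed

lemma tensor_span_UNIV: "tensor_span ten UNIV UNIV = range (tsum ten)"
  by (simp add: tensor_span_eq)

text \<open>Continuity of \<open>ten\<close> puts every elementary tensor into the closure, which is
  closed under addition; hence it contains the full algebraic tensor product, itself dense.\<close>

lemma tensor_span_dense:
  assumes A: "complex_vector.subspace A" "closure A = UNIV" and B: "closure B = UNIV"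
  shows "closure (tensor_span ten A B) = UNIV"
proof -
  let ?S = "tensor_span ten A B"
  have S: "0 \<in> ?S" "\<And>u v. u \<in> ?S \<Longrightarrow> v \<in> ?S \<Longrightarrow> u + v \<in> ?S"
    unfolding tensor_span_def by (auto intro: complex_vector.span_zero complex_vector.span_add)
  have ten: "ten a b \<in> closure ?S" for a b
  proof -
    have "(\<lambda>(a, b). ten a b) ` closure (A \<times> B) \<subseteq> closure ((\<lambda>(a, b). ten a b) ` (A \<times> B))"
      unfolding case_prod_unfold
      by (intro image_closure_subset closed_closure closure_subset
          bounded_bilinear.continuous_on[OF bounded_bilinear_ten] continuous_intros)
    also have "\<dots> \<subseteq> closure ?S"
      by (intro closure_mono) (auto simp: tensor_span_def intro!: complex_vector.span_base)
    finally show ?thesis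
      using A B by (auto simp: closure_Times)
  qed
  have add: "u + v \<in> closure ?S" if "u \<in> closure ?S" "v \<in> closure ?S" for u v
  proof -
    from that obtain f g where "\<forall>n. f n \<in> ?S" "f \<longlonglongrightarrow> u" "\<forall>n. g n \<in> ?S" "g \<longlonglongrightarrow> v"
      unfolding closure_sequential by blast
    then show ?thesis
      unfolding closure_sequential by (intro exI[of _ "\<lambda>n. f n + g n"]) (auto intro: S tendsto_add)
  qed
  have "tsum ten us \<in> closure ?S" for us
    by (induction us) (use S(1) closure_subset in \<open>auto intro!: add ten\<close>)
  then have "closure (tensor_span ten UNIV UNIV) \<subseteq> closure ?S"
    by (intro closure_minimal) (auto simp: tensor_span_UNIV)
  then show ?thesis
    using tensors_dense by auto
qed

text \<open>The bound is applied to \<open>us @ scale_list (- 1) vs\<close>, which represents the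
  difference. It is not assumed that \<open>h\<close> depends only on the tensor;
  \<open>lift_eq\<close> obtains this as the case of distance zero. Asking for the scalar -1 alone
  admits conjugate-linear \<open>h\<close> as well.\<close>

lemma lift_lipschitz:
  fixes h :: "('a \<times> 'b) list \<Rightarrow> 'c::real_normed_vector"
  assumes A: "complex_vector.subspace A"
    and add: "\<And>us vs. h (us @ vs) = h us + h vs"
    and neg: "\<And>us. us \<in> lists (A \<times> B) \<Longrightarrow> h (scale_list (- 1) us) = - h us"
    and bound: "\<And>us. us \<in> lists (A \<times> B) \<Longrightarrow> norm (h us) \<le> C * norm (tsum ten us)"
    and us: "us \<in> lists (A \<times> B)" "vs \<in> lists (A \<times> B)"
  shows "norm (h us - h vs) \<le> C * norm (tsum ten us - tsum ten vs)"
  using bound[of "us @ scale_list (- 1) vs"] us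
  by (simp add: add neg tsum_scale_list scaleC_minus_one scale_list_in_lists[OF A])

lemma lift_eq:
  fixes h :: "('a \<times> 'b) list \<Rightarrow> 'c::real_normed_vector"
  assumes "complex_vector.subspace A" "\<And>us vs. h (us @ vs) = h us + h vs"
    and "\<And>us. us \<in> lists (A \<times> B) \<Longrightarrow> h (scale_list (- 1) us) = - h us"
    and "\<And>us. us \<in> lists (A \<times> B) \<Longrightarrow> norm (h us) \<le> C * norm (tsum ten us)"
    and "us \<in> lists (A \<times> B)" "vs \<in> lists (A \<times> B)" "tsum ten us = tsum ten vs"
  shows "h us = h vs"
  using lift_lipschitz[OF assms(1-6)] assms(7) by simp

lemma norm_tsum_map_le:
  assumes R: "\<And>a b. R (a + b) = R a + R b" "\<And>c a. R (c *\<^sub>C a) = c *\<^sub>C R a"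
      "\<And>a. norm (R a) \<le> C * norm a" "C \<ge> 0"
    and T: "\<And>a b. T (a + b) = T a + T b" "\<And>c a. T (c *\<^sub>C a) = c *\<^sub>C T a"
      "\<And>a. norm (T a) \<le> D * norm a" "D \<ge> 0"
  shows "norm (tsum ten (map (map_prod R T) us)) \<le> C * D * norm (tsum ten us)"
proof -
  have pos: "positive_form (\<lambda>a b. cinner (R a) (R b))" "positive_form (\<lambda>a b. cinner (T a) (T b))"
    by (simp_all add: positive_form_def cinner_self sesquilinear_def R T
        sesquilinearD[OF sesquilinear_cinner])
  have le: "cmod (cinner (R a) (R a)) \<le> C\<^sup>2 * (norm a)\<^sup>2" for a
    using power_mono[OF R(3)[of a], of 2] by (simp add: cinner_self norm_power power_mult_distrib)
  have le': "cmod (cinner (T a) (T a)) \<le> D\<^sup>2 * (norm a)\<^sup>2" for a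
    using power_mono[OF T(3)[of a], of 2] by (simp add: cinner_self norm_power power_mult_distrib)
  \<comment> \<open>\<open>fsum_mono\<close> asks for positivity of the smaller first form and of
    the larger second form.\<close>
  have posD: "positive_form (\<lambda>a b :: 'b. of_real (D\<^sup>2) * cinner a b)"
    by (simp add: positive_form_def cinner_self sesquilinear_def algebra_simps
        sesquilinearD[OF sesquilinear_cinner] flip: of_real_power of_real_mult)
  have "(norm (tsum ten (map (map_prod R T) us)))\<^sup>2 =
      Re (fsum (\<lambda>a b. cinner (R a) (R b)) (\<lambda>a b. cinner (T a) (T b)) us us)"
    by (simp add: norm_tsum fsum_map)
  also have "\<dots> \<le> Re (fsum (\<lambda>a b. of_real (C\<^sup>2) * cinner a b) (\<lambda>a b. of_real (D\<^sup>2) * cinner a b) us us)"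
    by (rule fsum_mono[OF pos(1) posD positive_form_cinner_diff[OF pos(1) le]
          positive_form_cinner_diff[OF pos(2) le']])
  also have "\<dots> = Re (of_real ((C * D)\<^sup>2) * fsum cinner cinner us us)"
    by (simp add: fsum_def case_prod_unfold sum_list_const_mult[symmetric] power_mult_distrib
        mult.assoc mult.left_commute)
  also have "\<dots> = (C * D * norm (tsum ten us))\<^sup>2"
    by (simp add: norm_tsum power_mult_distrib flip: of_real_power of_real_mult)
  finally show ?thesis
    by (rule power2_le_imp_le) (use R T in simp)
qed

section \<open>The tensor product form: bound, independence of representations, extension\<close>

lemma fsum_bound:
  assumes "positive_form P" "\<And>a b. cmod (P a b) \<le> norm a * norm b"
    and "positive_form Q" "\<And>a b. cmod (Q a b) \<le> norm a * norm b"
  shows "cmod (fsum P Q us vs) \<le> norm (tsum ten us) * norm (tsum ten vs)"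
proof -
  have diag: "Re (fsum P Q us us) \<le> (norm (tsum ten us))\<^sup>2" for us
    unfolding norm_tsum
    using fsum_mono[OF assms(1) positive_form_cinner, of cinner Q us]
      positive_form_cinner_diff[OF assms(1), of 1] positive_form_cinner_diff[OF assms(3), of 1] assms(2,4)
    by (simp add: power2_eq_square)
  have "(cmod (fsum P Q us vs))\<^sup>2 \<le> Re (fsum P Q us us) * Re (fsum P Q vs vs)"
    by (rule fsum_cauchy_schwarz[OF assms(1,3)])
  also have "\<dots> \<le> (norm (tsum ten us))\<^sup>2 * (norm (tsum ten vs))\<^sup>2"
    using fsum_nonneg[OF assms(1,3)] by (intro mult_mono diag) (auto simp: complex_nonneg_Reals_iff)
  finally show ?thesis
    by (intro power2_le_imp_le[OF _ mult_nonneg_nonneg]) (auto simp: power_mult_distrib)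
qed

lemma tensor_form0_eq:
  assumes "positive_form P" "\<And>a b. cmod (P a b) \<le> norm a * norm b"
    and "positive_form Q" "\<And>a b. cmod (Q a b) \<le> norm a * norm b"
  shows "tensor_form0 ten P Q (tsum ten us) (tsum ten vs) = fsum P Q us vs"
proof (rule tensor_form0_tsum)
  note bound = fsum_bound[OF assms]
  note neg = fsum_scale[OF positive_form_sesquilinear[OF assms(1)], where c = "- 1"]
  fix us' vs' assume *: "tsum ten us' = tsum ten us" "tsum ten vs' = tsum ten vs"
  \<comment> \<open>The representations are exchanged one slot at a time; the norm of the tensor in
    the fixed slot serves as the constant.\<close>
  have "fsum P Q us' vs' = fsum P Q us vs'"
    by (rule lift_eq[where A = UNIV and B = UNIV and C = "norm (tsum ten vs')"])
      (use * bound[of _ vs'] in \<open>auto simp: neg mult.commute\<close>)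
  also have "\<dots> = fsum P Q us vs"
    by (rule lift_eq[where A = UNIV and B = UNIV and C = "norm (tsum ten us)"])
      (use * bound[of us] in \<open>auto simp: neg\<close>)
  finally show "fsum P Q us' vs' = fsum P Q us vs" .
qed

lemma
  assumes "positive_form P" "\<And>a b. cmod (P a b) \<le> norm a * norm b"
    and "positive_form Q" "\<And>a b. cmod (Q a b) \<le> norm a * norm b"
  shows tensor_form_tsum: "tensor_form ten P Q (tsum ten us) (tsum ten vs) = fsum P Q us vs"
    and continuous_form_tensor_form: "continuous_form (tensor_form ten P Q)"
proof -
  note bound = fsum_bound[OF assms]
  note neg = fsum_scale[OF positive_form_sesquilinear[OF assms(1)], where c = "- 1"]
  let ?D = "tensor_span ten UNIV UNIV" and ?f = "tensor_form0 ten P Q"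
  have l: "norm (?f x y - ?f x' y) \<le> norm (x - x') * norm y"
    if D: "x \<in> ?D" "x' \<in> ?D" "y \<in> ?D" for x x' y
  proof -
    obtain us us' vs where eq: "x = tsum ten us" "x' = tsum ten us'" "y = tsum ten vs"
      using D by (auto simp: tensor_span_UNIV)
    have "norm (fsum P Q us vs - fsum P Q us' vs) \<le>
        norm (tsum ten vs) * norm (tsum ten us - tsum ten us')"
      by (rule lift_lipschitz[where A = UNIV and B = UNIV])
        (use bound[of _ vs] in \<open>auto simp: neg mult.commute\<close>)
    then show ?thesis
      by (simp add: eq tensor_form0_eq[OF assms] mult.commute)
  qed
  have r: "norm (?f x y - ?f x y') \<le> norm x * norm (y - y')"
    if D: "x \<in> ?D" "y \<in> ?D" "y' \<in> ?D" for x y y'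
  proof -
    obtain us vs vs' where eq: "x = tsum ten us" "y = tsum ten vs" "y' = tsum ten vs'"
      using D by (auto simp: tensor_span_UNIV)
    have "norm (fsum P Q us vs - fsum P Q us vs') \<le>
        norm (tsum ten us) * norm (tsum ten vs - tsum ten vs')"
      by (rule lift_lipschitz[where A = UNIV and B = UNIV])
        (use bound[of us] in \<open>auto simp: neg\<close>)
    then show ?thesis
      by (simp add: eq tensor_form0_eq[OF assms])
  qed
  obtain g where g: "continuous_on UNIV (\<lambda>(x, y). g x y)"
      "\<And>x y. \<lbrakk>x \<in> ?D; y \<in> ?D\<rbrakk> \<Longrightarrow> g x y = ?f x y"
    using bounded_biadditive_extension[OF tensors_dense tensors_dense l r] by blast
  have "extension_by_continuity (?D \<times> ?D) (\<lambda>(x, y). ?f x y) = (\<lambda>(x, y). g x y)"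
    by (rule extension_by_continuity_eq) (use g tensors_dense in \<open>auto simp: closure_Times\<close>)
  then have eq: "tensor_form ten P Q = g"
    by (simp add: tensor_form_def fun_eq_iff)
  show "continuous_form (tensor_form ten P Q)"
    unfolding continuous_form_def eq by (rule g)
  show "tensor_form ten P Q (tsum ten us) (tsum ten vs) = fsum P Q us vs"
    using g(2)[of "tsum ten us" "tsum ten vs"]
    by (simp add: eq tensor_span_UNIV tensor_form0_eq[OF assms])
qed

end

lemma continuous_on_form:
  assumes "continuous_form F" "continuous_on S f" "continuous_on S g"
  shows "continuous_on S (\<lambda>x. F (f x) (g x))"
  using continuous_on_compose2[OF assms(1)[unfolded continuous_form_def]
      continuous_on_Pair[OF assms(2,3)]] by simp

lemma (in hilbert_tensor_product) tensor_form_bounded_positive: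
  assumes "positive_form P" "\<And>a b. cmod (P a b) \<le> norm a * norm b"
    and "positive_form Q" "\<And>a b. cmod (Q a b) \<le> norm a * norm b"
  shows "positive_form (tensor_form ten P Q)"
    and "cmod (tensor_form ten P Q \<psi> \<psi>') \<le> norm \<psi> * norm \<psi>'"
proof -
  note P = positive_form_sesquilinear[OF assms(1)]
  let ?F = "tensor_form ten P Q" and ?D = "range (tsum ten)"
  have D: "closure ?D = UNIV"
    using tensors_dense by (simp add: tensor_span_UNIV)
  note [continuous_intros] = continuous_on_form[OF continuous_form_tensor_form[OF assms]]
  note F = tensor_form_tsum[OF assms]
  have tsum_add: "?F (tsum ten us + tsum ten us') c = ?F (tsum ten us) c + ?F (tsum ten us') c"
      "?F c (tsum ten us + tsum ten us') = ?F c (tsum ten us) + ?F c (tsum ten us')"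
    if "c \<in> ?D" for us us' c
    using that by (auto simp: F simp flip: tsum_simps(3))
  have tsum_scale: "?F (k *\<^sub>C tsum ten us) c = k * ?F (tsum ten us) c"
      "?F c (k *\<^sub>C tsum ten us) = cnj k * ?F c (tsum ten us)" if "c \<in> ?D" for k us c
    using that by (auto simp: F fsum_scale[OF P] simp flip: tsum_scale_list)
  \<comment> \<open>Additivity involves three vectors: density is used for the two summands with
    \<open>c\<close> in the dense set, and afterwards for \<open>c\<close>.\<close>
  have left: "?F (a + b) c = ?F a c + ?F b c" if "c \<in> ?D" for a b c
    by (rule eq_on_dense2[OF D D, where f = "\<lambda>a b. ?F (a + b) c"
          and g = "\<lambda>a b. ?F a c + ?F b c"], (intro continuous_intros)+)
      (auto simp: tsum_add that)
  have right: "?F c (a + b) = ?F c a + ?F c b" if "c \<in> ?D" for a b c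
    by (rule eq_on_dense2[OF D D, where f = "\<lambda>a b. ?F c (a + b)"
          and g = "\<lambda>a b. ?F c a + ?F c b"], (intro continuous_intros)+)
      (auto simp: tsum_add that)
  have "?F (a + b) c = ?F a c + ?F b c" for a b c
    by (rule eq_on_dense[OF D, where f = "\<lambda>c. ?F (a + b) c"
          and g = "\<lambda>c. ?F a c + ?F b c"], (intro continuous_intros)+, rule left)
  moreover have "?F c (a + b) = ?F c a + ?F c b" for a b c
    by (rule eq_on_dense[OF D, where f = "\<lambda>c. ?F c (a + b)"
          and g = "\<lambda>c. ?F c a + ?F c b"], (intro continuous_intros)+, rule right)
  moreover have "?F (k *\<^sub>C a) b = k * ?F a b" for k a b
    by (rule eq_on_dense2[OF D D, where f = "\<lambda>a b. ?F (k *\<^sub>C a) b"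
          and g = "\<lambda>a b. k * ?F a b"], (intro continuous_intros)+)
      (auto simp: tsum_scale)
  moreover have "?F b (k *\<^sub>C a) = cnj k * ?F b a" for k a b
    by (rule eq_on_dense2[OF D D, where f = "\<lambda>a b. ?F b (k *\<^sub>C a)"
          and g = "\<lambda>a b. cnj k * ?F b a"], (intro continuous_intros)+)
      (auto simp: tsum_scale)
  moreover have "?F a a \<in> \<real>\<^sub>\<ge>\<^sub>0" for a
    unfolding complex_nonneg_Reals_iff
  proof
    show "0 \<le> Re (?F a a)"
      by (rule le_on_dense[OF D, where f = "\<lambda>_. 0" and g = "\<lambda>a. Re (?F a a)"])
        (use fsum_nonneg[OF assms(1,3)] in
          \<open>auto intro!: continuous_intros simp: F complex_nonneg_Reals_iff\<close>)
    show "Im (?F a a) = 0"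
      by (rule eq_on_dense[OF D, where f = "\<lambda>a. Im (?F a a)" and g = "\<lambda>_. 0"])
        (use fsum_nonneg[OF assms(1,3)] in
          \<open>auto intro!: continuous_intros simp: F complex_nonneg_Reals_iff\<close>)
  qed
  ultimately show "positive_form ?F"
    unfolding positive_form_def sesquilinear_def by blast
  show "cmod (?F \<psi> \<psi>') \<le> norm \<psi> * norm \<psi>'"
    by (rule le_on_dense2[OF D D, where f = "\<lambda>\<psi> \<psi>'. cmod (?F \<psi> \<psi>')"
        and g = "\<lambda>\<psi> \<psi>'. norm \<psi> * norm \<psi>'"])
      (auto intro!: continuous_intros simp: F fsum_bound[OF assms])
qed

section \<open>Products and involution\<close>

context hilbert_quasi_star_algebra
begin

lemma right_mul_continuous_on:
  "\<lbrakk>x \<in> A; continuous_on S f\<rbrakk> \<Longrightarrow> continuous_on S (\<lambda>a. f a \<cdot> x)"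
  by (rule continuous_on_compose2[OF right_mul_extended]) auto

lemma left_mul_continuous_on:
  "\<lbrakk>x \<in> A; continuous_on S f\<rbrakk> \<Longrightarrow> continuous_on S (\<lambda>a. x \<cdot> f a)"
  by (rule continuous_on_compose2[OF left_mul_extended]) auto

text \<open>The algebra laws are assumed inside \<open>A\<close>; with \<open>x\<close> in
  \<open>A\<close> both sides are continuous in the other arguments, so density of \<open>A\<close>
  extends them.\<close>

lemma right_mul_add: "x \<in> A \<Longrightarrow> (a + b) \<cdot> x = a \<cdot> x + b \<cdot> x"
  by (rule eq_on_dense2[OF dense dense, where f = "\<lambda>a b. (a + b) \<cdot> x"
        and g = "\<lambda>a b. a \<cdot> x + b \<cdot> x"])
    (auto intro!: continuous_intros right_mul_continuous_on simp: mul_add_left)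

lemma left_mul_add: "x \<in> A \<Longrightarrow> x \<cdot> (a + b) = x \<cdot> a + x \<cdot> b"
  by (rule eq_on_dense2[OF dense dense, where f = "\<lambda>a b. x \<cdot> (a + b)"
        and g = "\<lambda>a b. x \<cdot> a + x \<cdot> b"])
    (auto intro!: continuous_intros left_mul_continuous_on simp: mul_add_right)

lemma right_mul_scaleC: "x \<in> A \<Longrightarrow> (c *\<^sub>C a) \<cdot> x = c *\<^sub>C (a \<cdot> x)"
  by (rule eq_on_dense[OF dense, where f = "\<lambda>a. (c *\<^sub>C a) \<cdot> x"
        and g = "\<lambda>a. c *\<^sub>C (a \<cdot> x)"])
    (auto intro!: continuous_intros right_mul_continuous_on simp: mul_scaleC_left)

lemma left_mul_scaleC: "x \<in> A \<Longrightarrow> x \<cdot> (c *\<^sub>C a) = c *\<^sub>C (x \<cdot> a)"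
  by (rule eq_on_dense[OF dense, where f = "\<lambda>a. x \<cdot> (c *\<^sub>C a)"
        and g = "\<lambda>a. c *\<^sub>C (x \<cdot> a)"])
    (auto intro!: continuous_intros left_mul_continuous_on simp: mul_scaleC_right)

lemma right_mul_bounded:
  assumes "x \<in> A"
  obtains K where "K \<ge> 0" "\<And>a. norm (a \<cdot> x) \<le> K * norm a"
proof (rule continuous_linear_bounded)
  show "linear (\<lambda>a. a \<cdot> x)"
    by (rule linearI) (simp_all add: assms right_mul_add right_mul_scaleC scaleR_scaleC)
qed (use assms right_mul_extended in blast)+

lemma left_mul_bounded:
  assumes "x \<in> A"
  obtains K where "K \<ge> 0" "\<And>a. norm (x \<cdot> a) \<le> K * norm a"
proof (rule continuous_linear_bounded)
  show "linear (\<lambda>a. x \<cdot> a)"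
    by (rule linearI) (simp_all add: assms left_mul_add left_mul_scaleC scaleR_scaleC)
qed (use assms left_mul_extended in blast)+

end

section \<open>Multiplication and involution on the tensor product\<close>

locale tensor_product_algebras =
  hilbert_tensor_product ten +
  A: hilbert_quasi_star_algebra A mulA starA +
  B: hilbert_quasi_star_algebra B mulB starB
  for ten :: "'a::complex_hilbert \<Rightarrow> 'b::complex_hilbert \<Rightarrow> 'k::complex_hilbert"
    and A :: "'a set" and mulA :: "'a \<Rightarrow> 'a \<Rightarrow> 'a" and starA :: "'a \<Rightarrow> 'a"
    and B :: "'b set" and mulB :: "'b \<Rightarrow> 'b \<Rightarrow> 'b" and starB :: "'b \<Rightarrow> 'b"
begin

abbreviation "formal \<equiv> lists (A \<times> B)"
abbreviation "star_list \<equiv> map (map_prod starA starB)"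

lemma star_list_formal: "us \<in> formal \<Longrightarrow> star_list us \<in> formal"
  by (induction us) (auto simp: A.star_closed B.star_closed)

lemma tsum_mul_list_append_right:
  "tsum ten (mul_list mulA mulB us (vs @ vs')) =
   tsum ten (mul_list mulA mulB us vs) + tsum ten (mul_list mulA mulB us vs')"
  by (induction us) (auto simp: ac_simps)

lemma tsum_mul_list_scale_left:
  assumes "vs \<in> formal"
  shows "tsum ten (mul_list mulA mulB (scale_list c us) vs) = c *\<^sub>C tsum ten (mul_list mulA mulB us vs)"
proof (induction us)
  case (Cons p us)
  have "map (map_prod (mulA (c *\<^sub>C x)) (mulB y)) vs = scale_list c (map (map_prod (mulA x) (mulB y)) vs)"
    for x y
    using assms by (induction vs) (auto simp: A.right_mul_scaleC)
  then show ?case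
    using Cons by (cases p) (simp add: tsum_scale_list scaleC_add_right)
qed simp

lemma tsum_mul_list_scale_right:
  assumes "us \<in> formal"
  shows "tsum ten (mul_list mulA mulB us (scale_list c vs)) = c *\<^sub>C tsum ten (mul_list mulA mulB us vs)"
  using assms
proof (induction us)
  case (Cons p us)
  have "map (map_prod (mulA x) (mulB y)) (scale_list c vs) = scale_list c (map (map_prod (mulA x) (mulB y)) vs)"
    if "x \<in> A" for x y
    using that by (induction vs) (auto simp: A.left_mul_scaleC)
  then show ?case
    using Cons by (cases p) (auto simp: tsum_scale_list scaleC_add_right)
qed simp

text \<open>Multiplication by \<open>vs\<close> from the right is a finite sum of tensor products of
  bounded right multiplications, one for each pair; each pair adds its \<open>C * D\<close> to the
  constant.\<close>

lemma norm_tsum_mul_list_right: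
  assumes "vs \<in> formal"
  shows "\<exists>K\<ge>0. \<forall>us. norm (tsum ten (mul_list mulA mulB us vs)) \<le> K * norm (tsum ten us)"
  using assms
proof (induction vs)
  case (Cons p vs)
  then obtain K x y where K: "K \<ge> 0" "\<And>us. norm (tsum ten (mul_list mulA mulB us vs)) \<le> K * norm (tsum ten us)"
      and p: "p = (x, y)" "x \<in> A" "y \<in> B"
    by auto
  obtain C where C: "C \<ge> 0" "\<And>a. norm (mulA a x) \<le> C * norm a"
    using A.right_mul_bounded[OF p(2)] by blast
  obtain D where D: "D \<ge> 0" "\<And>a. norm (mulB a y) \<le> D * norm a"
    using B.right_mul_bounded[OF p(3)] by blast
  have "norm (tsum ten (map (map_prod (\<lambda>a. mulA a x) (\<lambda>b. mulB b y)) us)) \<le> C * D * norm (tsum ten us)" for us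
    by (rule norm_tsum_map_le)
      (simp_all add: p A.right_mul_add A.right_mul_scaleC B.right_mul_add B.right_mul_scaleC C D)
  then have "norm (tsum ten (mul_list mulA mulB us (p # vs))) \<le> (C * D + K) * norm (tsum ten us)" for us
    unfolding p tsum_mul_list_Cons distrib_right by (intro norm_triangle_mono K)
  then show ?case
    using C D K by (intro exI[of _ "C * D + K"]) simp
qed (auto intro: exI[of _ 0])

lemma norm_tsum_mul_list_left:
  assumes "us \<in> formal"
  shows "\<exists>K\<ge>0. \<forall>vs. norm (tsum ten (mul_list mulA mulB us vs)) \<le> K * norm (tsum ten vs)"
  using assms
proof (induction us)
  case (Cons p us)
  then obtain K x y where K: "K \<ge> 0" "\<And>vs. norm (tsum ten (mul_list mulA mulB us vs)) \<le> K * norm (tsum ten vs)"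
      and p: "p = (x, y)" "x \<in> A" "y \<in> B"
    by auto
  obtain C where C: "C \<ge> 0" "\<And>a. norm (mulA x a) \<le> C * norm a"
    using A.left_mul_bounded[OF p(2)] by blast
  obtain D where D: "D \<ge> 0" "\<And>a. norm (mulB y a) \<le> D * norm a"
    using B.left_mul_bounded[OF p(3)] by blast
  have "norm (tsum ten (map (map_prod (mulA x) (mulB y)) vs)) \<le> C * D * norm (tsum ten vs)" for vs
    by (rule norm_tsum_map_le)
      (simp_all add: p A.left_mul_add A.left_mul_scaleC B.left_mul_add B.left_mul_scaleC C D)
  then have "norm (tsum ten (mul_list mulA mulB (p # us) vs)) \<le> (C * D + K) * norm (tsum ten vs)" for vs
    unfolding p mul_list_simps tsum_simps distrib_right by (intro norm_triangle_mono K)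
  then show ?case
    using C D K by (intro exI[of _ "C * D + K"]) simp
qed (auto intro: exI[of _ 0])

lemma lipschitz_tsum_mul_list:
  assumes "vs \<in> formal"
  obtains K where "K \<ge> 0" "\<And>us us'. \<lbrakk>us \<in> formal; us' \<in> formal\<rbrakk> \<Longrightarrow>
    norm (tsum ten (mul_list mulA mulB us vs) - tsum ten (mul_list mulA mulB us' vs)) \<le>
    K * norm (tsum ten us - tsum ten us')"
proof -
  obtain K where K: "K \<ge> 0" "\<And>us. norm (tsum ten (mul_list mulA mulB us vs)) \<le> K * norm (tsum ten us)"
    using norm_tsum_mul_list_right[OF assms] by blast
  show ?thesis
    by (rule that[OF K(1)], rule lift_lipschitz[OF A.subspace])
      (auto simp only: mul_list_simps tsum_simps tsum_mul_list_scale_left[OF assms] scaleC_minus_one K(2))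
qed

lemma tsum_mul_list_cong:
  assumes "us \<in> formal" "us' \<in> formal" "vs \<in> formal" "vs' \<in> formal"
    and "tsum ten us = tsum ten us'" "tsum ten vs = tsum ten vs'"
  shows "tsum ten (mul_list mulA mulB us vs) = tsum ten (mul_list mulA mulB us' vs')"
proof -
  obtain K where K: "\<And>vs. norm (tsum ten (mul_list mulA mulB us vs)) \<le> K * norm (tsum ten vs)"
    using norm_tsum_mul_list_left[OF assms(1)] by blast
  \<comment> \<open>The right representation is exchanged with the left bound for \<open>us\<close>,
    then the left one with the right bound for \<open>vs'\<close>.\<close>
  have "tsum ten (mul_list mulA mulB us vs) = tsum ten (mul_list mulA mulB us vs')"
    by (rule lift_eq[OF A.subspace, where C = K])
      (use assms in \<open>auto simp only: tsum_mul_list_append_right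
        tsum_mul_list_scale_right[OF assms(1)] scaleC_minus_one K\<close>)
  also have "\<dots> = tsum ten (mul_list mulA mulB us' vs')"
  proof -
    obtain L where "norm (tsum ten (mul_list mulA mulB us vs') - tsum ten (mul_list mulA mulB us' vs')) \<le>
        L * norm (tsum ten us - tsum ten us')"
      using lipschitz_tsum_mul_list[OF assms(4)] assms(1,2) by metis
    then show ?thesis using assms(5) by simp
  qed
  finally show ?thesis .
qed

abbreviation "tensor_algebra \<equiv> tensor_span ten A B"

lemma tensor_algebra_eq: "tensor_algebra = tsum ten ` formal"
  by (rule tensor_span_eq[OF A.subspace])

lemma tensor_algebra_dense: "closure tensor_algebra = UNIV"
  by (rule tensor_span_dense[OF A.subspace A.dense B.dense])

text \<open>Both products in condition (ii) have their right factor in the algebra, so the right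
  factor is fixed here and the left one is extended by continuity.\<close>

lemma
  assumes vs: "vs \<in> formal"
  shows tensor_mul_tsum: "us \<in> formal \<Longrightarrow>
      tensor_mul ten A mulA B mulB (tsum ten us) (tsum ten vs) = tsum ten (mul_list mulA mulB us vs)"
    and continuous_tensor_mul: "continuous_on UNIV (\<lambda>\<psi>. tensor_mul ten A mulA B mulB \<psi> (tsum ten vs))"
proof -
  let ?f = "\<lambda>z. tensor_mul0 ten A mulA B mulB z (tsum ten vs)"
  have f: "?f (tsum ten us) = tsum ten (mul_list mulA mulB us vs)" if "us \<in> formal" for us
    by (rule tensor_mul0_tsum[OF that vs]) (rule tsum_mul_list_cong[OF _ that _ vs])
  obtain K where K: "K \<ge> 0" "\<And>us us'. \<lbrakk>us \<in> formal; us' \<in> formal\<rbrakk> \<Longrightarrow>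
      norm (tsum ten (mul_list mulA mulB us vs) - tsum ten (mul_list mulA mulB us' vs)) \<le>
      K * norm (tsum ten us - tsum ten us')"
    using lipschitz_tsum_mul_list[OF vs] by blast
  have lip: "K-lipschitz_on tensor_algebra ?f"
  proof (rule lipschitz_onI)
    fix z z' assume "z \<in> tensor_algebra" "z' \<in> tensor_algebra"
    then obtain us us' where "z = tsum ten us" "us \<in> formal" "z' = tsum ten us'" "us' \<in> formal"
      unfolding tensor_algebra_eq by blast
    then show "dist (?f z) (?f z') \<le> K * dist z z'"
      using K(2)[of us us'] f[of us] f[of us'] by (simp add: dist_norm)
  qed (rule K)
  have eq: "(\<lambda>\<psi>. tensor_mul ten A mulA B mulB \<psi> (tsum ten vs)) = extension_by_continuity tensor_algebra ?f"
    using vs by (simp add: tensor_mul_def tensor_algebra_eq)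
  show "continuous_on UNIV (\<lambda>\<psi>. tensor_mul ten A mulA B mulB \<psi> (tsum ten vs))"
    unfolding eq by (rule continuous_on_extension_by_continuity[OF lip tensor_algebra_dense])
  show "us \<in> formal \<Longrightarrow>
      tensor_mul ten A mulA B mulB (tsum ten us) (tsum ten vs) = tsum ten (mul_list mulA mulB us vs)"
    using fun_cong[OF eq, of "tsum ten us"] extension_by_continuity_agrees[OF lip tensor_algebra_dense] f[of us]
    unfolding tensor_algebra_eq by (metis imageI)
qed

text \<open>In each factor \<open>cinner_star\<close> and hermitian symmetry give conjugation of the
  inner product under the involution. Hence \<open>fsum cinner cinner\<close> is conjugated too,
  which leaves the real part of its diagonal unchanged.\<close>

lemma norm_tsum_star_list:
  assumes "us \<in> formal"
  shows "norm (tsum ten (star_list us)) = norm (tsum ten us)"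
proof -
  have inner: "(\<Sum>(x', y')\<leftarrow>star_list vs. cinner (starA x) x' * cinner (starB y) y') =
      cnj (\<Sum>(x', y')\<leftarrow>vs. cinner x x' * cinner y y')" if "x \<in> A" "y \<in> B" "vs \<in> formal" for x y vs
    using that(3)
  proof (induction vs)
    case (Cons p vs)
    then obtain x' y' where p: "p = (x', y')" "x' \<in> A" "y' \<in> B" by auto
    have "cinner (starA x) (starA x') = cnj (cinner x x')" "cinner (starB y) (starB y') = cnj (cinner y y')"
      using A.cinner_star[of x' x] B.cinner_star[of y' y] that p
        cinner_commute[of x' x] cinner_commute[of y' y] by simp_all
    then show ?case using Cons p by simp
  qed simp
  have "fsum cinner cinner (star_list us) (star_list vs) = cnj (fsum cinner cinner us vs)"
    if "vs \<in> formal" for vs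
    using assms
  proof (induction us)
    case (Cons p us)
    then show ?case using inner[OF _ _ that] by (cases p) (simp add: fsum_Cons1)
  qed simp
  then have "(norm (tsum ten (star_list us)))\<^sup>2 = (norm (tsum ten us))\<^sup>2"
    using assms by (simp add: norm_tsum)
  then show ?thesis
    by (rule power2_eq_imp_eq) auto
qed

lemma norm_tsum_star_list_diff:
  assumes "us \<in> formal" "vs \<in> formal"
  shows "norm (tsum ten (star_list us) - tsum ten (star_list vs)) \<le> 1 * norm (tsum ten us - tsum ten vs)"
proof (rule lift_lipschitz[OF A.subspace _ _ _ assms])
  fix us assume us: "us \<in> formal"
  then have "star_list (scale_list (- 1) us) = scale_list (- 1) (star_list us)"
    by (induction us)
      (auto simp: A.star_scaleC[where c = "- 1", unfolded scaleC_minus_one] scaleC_minus_one)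
  then show "tsum ten (star_list (scale_list (- 1) us)) = - tsum ten (star_list us)"
    by (simp add: tsum_scale_list scaleC_minus_one)
qed (simp_all add: norm_tsum_star_list)

lemma
  shows tensor_star_tsum: "us \<in> formal \<Longrightarrow>
      tensor_star ten A starA B starB (tsum ten us) = tsum ten (star_list us)"
    and continuous_tensor_star: "continuous_on UNIV (tensor_star ten A starA B starB)"
proof -
  let ?f = "tensor_star0 ten A starA B starB"
  have f: "?f (tsum ten us) = tsum ten (star_list us)" if "us \<in> formal" for us
  proof (rule tensor_star0_tsum[OF that])
    fix us' assume "us' \<in> formal" "tsum ten us' = tsum ten us"
    then show "tsum ten (star_list us') = tsum ten (star_list us)"
      using norm_tsum_star_list_diff[OF \<open>us' \<in> formal\<close> that] by simp
  qed
  have lip: "1-lipschitz_on tensor_algebra ?f"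
  proof (rule lipschitz_onI)
    fix z z' assume "z \<in> tensor_algebra" "z' \<in> tensor_algebra"
    then obtain us us' where "z = tsum ten us" "us \<in> formal" "z' = tsum ten us'" "us' \<in> formal"
      unfolding tensor_algebra_eq by blast
    then show "dist (?f z) (?f z') \<le> 1 * dist z z'"
      using norm_tsum_star_list_diff[of us us'] f[of us] f[of us'] by (simp add: dist_norm)
  qed simp
  show "continuous_on UNIV (tensor_star ten A starA B starB)"
    unfolding tensor_star_def by (rule continuous_on_extension_by_continuity[OF lip tensor_algebra_dense])
  show "us \<in> formal \<Longrightarrow> tensor_star ten A starA B starB (tsum ten us) = tsum ten (star_list us)"
    using extension_by_continuity_agrees[OF lip tensor_algebra_dense] f[of us]
    unfolding tensor_algebra_eq tensor_star_def by (metis imageI)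
qed

text \<open>For each pair (a, b) of \<open>us\<close>, the elements \<open>a\<close> and
  \<open>b\<close> move across \<open>P\<close> and \<open>Q\<close> separately. The outer loop over
  \<open>us\<close> is the same on both sides, so the terms match without rearrangement.\<close>

lemma fsum_mul_list:
  assumes P: "\<And>a x y. \<lbrakk>x \<in> A; y \<in> A\<rbrakk> \<Longrightarrow> P (mulA a x) y = P x (mulA (starA a) y)"
    and Q: "\<And>a x y. \<lbrakk>x \<in> B; y \<in> B\<rbrakk> \<Longrightarrow> Q (mulB a x) y = Q x (mulB (starB a) y)"
    and vs: "vs \<in> formal" and ws: "ws \<in> formal"
  shows "fsum P Q (mul_list mulA mulB us vs) ws = fsum P Q vs (mul_list mulA mulB (star_list us) ws)"
proof (induction us)
  case (Cons p us)
  obtain a b where p: "p = (a, b)" by (cases p)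
  have "(\<Sum>(x', y')\<leftarrow>ws. P (mulA a x) x' * Q (mulB b y) y') =
      (\<Sum>(x', y')\<leftarrow>map (map_prod (mulA (starA a)) (mulB (starB b))) ws. P x x' * Q y y')"
    if "x \<in> A" "y \<in> B" for x y
    using ws that by (induction ws) (auto simp: P Q)
  then have "fsum P Q (map (map_prod (mulA a) (mulB b)) vs) ws =
      fsum P Q vs (map (map_prod (mulA (starA a)) (mulB (starB b))) ws)"
    using vs by (induction vs) (auto simp: fsum_Cons1)
  then show ?case using Cons by (simp add: p)
qed simp

end

theorem theorem4p2:
  fixes A\<^sub>0 :: "'a::complex_hilbert set"
    and mul\<^sub>1 :: "'a \<Rightarrow> 'a \<Rightarrow> 'a" and star\<^sub>1 :: "'a \<Rightarrow> 'a"
    and B\<^sub>0 :: "'b::complex_hilbert set"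
    and mul\<^sub>2 :: "'b \<Rightarrow> 'b \<Rightarrow> 'b" and star\<^sub>2 :: "'b \<Rightarrow> 'b"
    and ten :: "'a \<Rightarrow> 'b \<Rightarrow> 'k::complex_hilbert"
    and \<phi>\<^sub>1 :: "'a \<Rightarrow> 'a \<Rightarrow> complex" and \<phi>\<^sub>2 :: "'b \<Rightarrow> 'b \<Rightarrow> complex"
  assumes "unital_hilbert_quasi_star_algebra A\<^sub>0 mul\<^sub>1 star\<^sub>1"
    and "unital_hilbert_quasi_star_algebra B\<^sub>0 mul\<^sub>2 star\<^sub>2"
    and "hilbert_tensor_product ten"
    and "\<phi>\<^sub>1 \<in> S_forms A\<^sub>0 mul\<^sub>1 star\<^sub>1"
    and "\<phi>\<^sub>2 \<in> S_forms B\<^sub>0 mul\<^sub>2 star\<^sub>2"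
  shows "tensor_form ten \<phi>\<^sub>1 \<phi>\<^sub>2 \<in>
    S_forms (tensor_span ten A\<^sub>0 B\<^sub>0)
      (tensor_mul ten A\<^sub>0 mul\<^sub>1 B\<^sub>0 mul\<^sub>2) (tensor_star ten A\<^sub>0 star\<^sub>1 B\<^sub>0 star\<^sub>2)"
proof -
  interpret tensor_product_algebras ten A\<^sub>0 mul\<^sub>1 star\<^sub>1 B\<^sub>0 mul\<^sub>2 star\<^sub>2
    using assms(1-3)
    by (simp add: tensor_product_algebras_def unital_hilbert_quasi_star_algebra_def)
  have \<phi>: "positive_form \<phi>\<^sub>1" "\<And>a b. cmod (\<phi>\<^sub>1 a b) \<le> norm a * norm b"
      "positive_form \<phi>\<^sub>2" "\<And>a b. cmod (\<phi>\<^sub>2 a b) \<le> norm a * norm b"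
    and \<phi>_mul: "\<And>a x y. \<lbrakk>x \<in> A\<^sub>0; y \<in> A\<^sub>0\<rbrakk> \<Longrightarrow> \<phi>\<^sub>1 (mul\<^sub>1 a x) y = \<phi>\<^sub>1 x (mul\<^sub>1 (star\<^sub>1 a) y)"
      "\<And>a x y. \<lbrakk>x \<in> B\<^sub>0; y \<in> B\<^sub>0\<rbrakk> \<Longrightarrow> \<phi>\<^sub>2 (mul\<^sub>2 a x) y = \<phi>\<^sub>2 x (mul\<^sub>2 (star\<^sub>2 a) y)"
    using assms(4,5) unfolding S_forms_def positive_form_def by blast+
  let ?F = "tensor_form ten \<phi>\<^sub>1 \<phi>\<^sub>2" and ?mul = "tensor_mul ten A\<^sub>0 mul\<^sub>1 B\<^sub>0 mul\<^sub>2"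
    and ?star = "tensor_star ten A\<^sub>0 star\<^sub>1 B\<^sub>0 star\<^sub>2"
  have "?F (?mul \<psi> z) z' = ?F z (?mul (?star \<psi>) z')" if z: "z \<in> tensor_algebra" "z' \<in> tensor_algebra" for \<psi> z z'
  proof -
    obtain vs ws where vs: "vs \<in> formal" "z = tsum ten vs" and ws: "ws \<in> formal" "z' = tsum ten ws"
      using z unfolding tensor_algebra_eq by blast
    show ?thesis
    \<comment> \<open>With \<open>z\<close> and \<open>z'\<close> fixed in the algebra, both sides
      are continuous in \<open>\<psi>\<close>, so it suffices to check \<open>\<psi>\<close> given
      by lists, where everything is an \<open>fsum\<close>.\<close>
    proof (rule eq_on_dense[OF tensor_algebra_dense, where f = "\<lambda>\<psi>. ?F (?mul \<psi> z) z'"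
        and g = "\<lambda>\<psi>. ?F z (?mul (?star \<psi>) z')"])
      note cont = continuous_on_form[OF continuous_form_tensor_form[OF \<phi>]]
      show "continuous_on UNIV (\<lambda>\<psi>. ?F (?mul \<psi> z) z')"
        unfolding vs(2) by (intro cont continuous_tensor_mul vs continuous_on_const)
      show "continuous_on UNIV (\<lambda>\<psi>. ?F z (?mul (?star \<psi>) z'))"
        unfolding ws(2)
        by (intro cont continuous_on_compose2[OF continuous_tensor_mul[OF ws(1)]]
            continuous_tensor_star continuous_on_const) auto
      fix \<psi> assume "\<psi> \<in> tensor_algebra"
      then obtain us where us: "us \<in> formal" "\<psi> = tsum ten us"
        unfolding tensor_algebra_eq by blast
      show "?F (?mul \<psi> z) z' = ?F z (?mul (?star \<psi>) z')"
        unfolding us(2) vs(2) ws(2) tensor_star_tsum[OF us(1)] tensor_mul_tsum[OF vs(1) us(1)]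
          tensor_mul_tsum[OF ws(1) star_list_formal[OF us(1)]] tensor_form_tsum[OF \<phi>]
        by (rule fsum_mul_list[OF \<phi>_mul vs(1) ws(1)])
    qed
  qed
  then show ?thesis
    using tensor_form_bounded_positive[OF \<phi>] continuous_form_tensor_form[OF \<phi>]
    unfolding S_forms_def positive_form_def by blast
qed

end
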